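(* Let $k$ be an algebraically closed field, $Q'$ a finite acyclic quiver, and $Q$ the subquiver with $Q_0 = Q'_0$ and $Q'_1 = Q_1 \cup \{e'\}$, $e' \notin Q_1$; write $s = s(e')$, $t = t(e')$. Let $M' = (M_v, \varphi_a)_{v \in Q'_0, a \in Q'_1}$ be a representation of $Q'$ over $k$ of total dimension $n = \sum_v \dim M_v$ which is a brick, and such that $\varphi_{e'}: M_s \to M_t$ is not of full rank. Let $M = (M_v, \varphi_a)_{v \in Q_0, a \in Q_1}$ be its restriction to $Q$. Choose complements $M_s = \mathrm{Ker}\,\varphi_{e'} \oplus M'_s$ and $M_t = \mathrm{Im}\,\varphi_{e'} \oplus M'_t$, so that, in block form with respect to these decompositions, $$\varphi_{e'} = \begin{pmatrix} 0 & \varphi \\ 0 & 0\end{pmatrix}$$ with $\varphi: M'_s \to \mathrm{Im}\,\varphi_{e'}$. Fix a basis of $\bigoplus_v M_v$ adapted to these decompositions, with the basis of $M_s$ first, then that of $M_t$, then the remaining vertex spaces, and let $f_0: kQ \to M_n(k)$ be the resulting homomorphism giving the action of $kQ$ on $M$ (so $f_0(e_s)$ and $f_0(e_t)$ are the block-diagonal idempotents $\mathrm{diag}(I_{\dim M_s},0,0)$ and $\mathrm{diag}(0,I_{\dim M_t},0)$). Assume that $\mathrm{Ker}\,\varphi_{e'}$ and $\mathrm{Im}\,\varphi_{e'}$ are invariant under the components at $s$ and $t$, respectively, of every endomorphism of the representation $M$ of $Q$. Then there is a ring epimorphism $f: kQ' \to M_n(k\langle X\rangle)$ which agrees with $f_0$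 on $kQ$ (composed with $M_n(k) \subseteq M_n(k\langle X \rangle)$) and sends $e'$ to the block matrix having $f_{e'}$ in the (rows of $M_t$, columns of $M_s$) block and $0$ elsewhere, where $f_{e'}$, written in block form with respect to $M_s = \mathrm{Ker}\,\varphi_{e'}\oplus M'_s$ and $M_t = \mathrm{Im}\,\varphi_{e'}\oplus M'_t$, is: (i) $f_{e'} = \begin{pmatrix} 0 & \varphi \\ X_{21} & 0 \end{pmatrix}$; (ii) if moreover $M'_s$ is invariant under all endomorphisms of $M$: $f_{e'} = \begin{pmatrix} X_{11} & \varphi \\ X_{21} & 0 \end{pmatrix}$; (iii) if moreover $M'_t$ is invariant under all endomorphisms of $M$: $f_{e'} = \begin{pmatrix} 0 & \varphi \\ X_{21} & X_{22} \end{pmatrix}$; (iv) if moreover both $M'_s$ and $M'_t$ are invariant under all endomorphisms of $M$: $f_{e'} = \begin{pmatrix} X_{11} & \varphi \\ X_{21} & X_{22} \end{pmatrix}$. Here $X_{11}, X_{21}, X_{22}$ are matrices of pairwise distinct indeterminates of the appropriate sizes, and $X$ is the set of all indeterminates appearing in $f_{e'}$.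
   Context: A representation of a quiver is a brick if its endomorphism ring is $k$. $k\langle X\rangle$ is the free associative $k$-algebra on the set $X$. A ring homomorphism $\varphi: R \to S$ is a ring epimorphism if for any two ring homomorphisms $\varrho_1, \varrho_2: S \to T$ with $\varrho_1\varphi = \varrho_2\varphi$ one has $\varrho_1 = \varrho_2$. Right $kQ$-modules are identified with representations of $Q$; an arrow $a$ acts as a matrix supported in the (rows of $M_{t(a)}$, columns of $M_{s(a)}$) block. *)

theory Defs
  imports "HOL-Algebra.Ring" "HOL-Computational_Algebra.Polynomial"
begin

definition alg_closed :: "'k::field itself \<Rightarrow> bool" where
  "alg_closed _ \<longleftrightarrow> (\<forall>p::'k poly. degree p > 0 \<longrightarrow> (\<exists>x. poly p x = 0))"

text \<open>A quiver is given by a vertex set Q0, an arrow set Q1 and source/target maps.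
  A path is a pair (v, as): v is its source vertex and as = [a1,...,am] is the
  composite a1 \<circ> ... \<circ> am (am is traversed first); (v, []) is the trivial path e_v.\<close>

definition quiver :: "'v set \<Rightarrow> 'a set \<Rightarrow> ('a \<Rightarrow> 'v) \<Rightarrow> ('a \<Rightarrow> 'v) \<Rightarrow> bool" where
  "quiver Q0 Q1 src tgt \<longleftrightarrow> (\<forall>a\<in>Q1. src a \<in> Q0 \<and> tgt a \<in> Q0)"

definition finite_quiver :: "'v set \<Rightarrow> 'a set \<Rightarrow> ('a \<Rightarrow> 'v) \<Rightarrow> ('a \<Rightarrow> 'v) \<Rightarrow> bool" where
  "finite_quiver Q0 Q1 src tgt \<longleftrightarrow> quiver Q0 Q1 src tgt \<and> finite Q0 \<and> finite Q1"

definition valid_path :: "'v set \<Rightarrow> 'a set \<Rightarrow> ('a \<Rightarrow> 'v) \<Rightarrow> ('a \<Rightarrow> 'v) \<Rightarrow> 'v \<times> 'a list \<Rightarrow> bool" where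
  "valid_path Q0 Q1 src tgt p \<longleftrightarrow>
     fst p \<in> Q0 \<and> set (snd p) \<subseteq> Q1 \<and>
     (snd p \<noteq> [] \<longrightarrow> src (last (snd p)) = fst p) \<and>
     (\<forall>i. Suc i < length (snd p) \<longrightarrow> src (snd p ! i) = tgt (snd p ! Suc i))"

definition path_src :: "'v \<times> 'a list \<Rightarrow> 'v" where
  "path_src p = fst p"

definition path_tgt :: "('a \<Rightarrow> 'v) \<Rightarrow> 'v \<times> 'a list \<Rightarrow> 'v" where
  "path_tgt tgt p = (if snd p = [] then fst p else tgt (hd (snd p)))"

definition acyclic_quiver :: "'v set \<Rightarrow> 'a set \<Rightarrow> ('a \<Rightarrow> 'v) \<Rightarrow> ('a \<Rightarrow> 'v) \<Rightarrow> bool" where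
  "acyclic_quiver Q0 Q1 src tgt \<longleftrightarrow>
     (\<forall>p. valid_path Q0 Q1 src tgt p \<and> snd p \<noteq> [] \<longrightarrow> path_tgt tgt p \<noteq> path_src p)"

definition path_algebra ::
  "'v set \<Rightarrow> 'a set \<Rightarrow> ('a \<Rightarrow> 'v) \<Rightarrow> ('a \<Rightarrow> 'v) \<Rightarrow> (('v \<times> 'a list) \<Rightarrow> 'k::field) ring" where
  "path_algebra Q0 Q1 src tgt =
    \<lparr> carrier = {x. finite {p. x p \<noteq> 0} \<and> (\<forall>p. x p \<noteq> 0 \<longrightarrow> valid_path Q0 Q1 src tgt p)},
      monoid.mult = (\<lambda>x y w. \<Sum>p\<in>{p. x p \<noteq> 0}. \<Sum>q\<in>{q. y q \<noteq> 0}.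
                 (if path_src p = path_tgt tgt q \<and> (fst q, snd p @ snd q) = w
                  then x p * y q else 0)),
      monoid.one = (\<lambda>p. if snd p = [] \<and> fst p \<in> Q0 then 1 else 0),
      ring.zero = (\<lambda>p. 0),
      ring.add = (\<lambda>x y p. x p + y p) \<rparr>"

definition path_elem :: "'v \<times> 'a list \<Rightarrow> ('v \<times> 'a list) \<Rightarrow> 'k::field" where
  "path_elem p = (\<lambda>q. if q = p then 1 else 0)"

definition free_algebra :: "'x set \<Rightarrow> ('x list \<Rightarrow> 'k::field) ring" where
  "free_algebra X =
    \<lparr> carrier = {f. finite {w. f w \<noteq> 0} \<and> (\<forall>w. f w \<noteq> 0 \<longrightarrow> set w \<subseteq> X)},
      monoid.mult = (\<lambda>f g w. \<Sum>i\<le>length w. f (take i w) * g (drop i w)),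
      monoid.one = (\<lambda>w. if w = [] then 1 else 0),
      ring.zero = (\<lambda>w. 0),
      ring.add = (\<lambda>f g w. f w + g w) \<rparr>"

definition nc_const :: "'k::field \<Rightarrow> 'x list \<Rightarrow> 'k" where
  "nc_const c = (\<lambda>w. if w = [] then c else 0)"

definition nc_var :: "'x \<Rightarrow> 'x list \<Rightarrow> 'k::field" where
  "nc_var x = (\<lambda>w. if w = [x] then 1 else 0)"

definition matrix_ring :: "nat \<Rightarrow> ('r, 'm) ring_scheme \<Rightarrow> (nat \<Rightarrow> nat \<Rightarrow> 'r) ring" where
  "matrix_ring n R =
    \<lparr> carrier = {A. \<forall>i j. (i < n \<and> j < n \<longrightarrow> A i j \<in> carrier R) \<and>
                          (\<not> (i < n \<and> j < n) \<longrightarrow> A i j = \<zero>\<^bsub>R\<^esub>)},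
      monoid.mult = (\<lambda>A B i j. if i < n \<and> j < n then finsum R (\<lambda>l. A i l \<otimes>\<^bsub>R\<^esub> B l j) {..<n}
                        else \<zero>\<^bsub>R\<^esub>),
      monoid.one = (\<lambda>i j. if i < n \<and> j < n then (if i = j then \<one>\<^bsub>R\<^esub> else \<zero>\<^bsub>R\<^esub>) else \<zero>\<^bsub>R\<^esub>),
      ring.zero = (\<lambda>i j. \<zero>\<^bsub>R\<^esub>),
      ring.add = (\<lambda>A B i j. if i < n \<and> j < n then A i j \<oplus>\<^bsub>R\<^esub> B i j else \<zero>\<^bsub>R\<^esub>) \<rparr>"

definition ring_epimorphism ::
  "'c itself \<Rightarrow> ('a, 'm) ring_scheme \<Rightarrow> ('b, 'n) ring_scheme \<Rightarrow> ('a \<Rightarrow> 'b) \<Rightarrow> bool" where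
  "ring_epimorphism _ R S f \<longleftrightarrow>
     f \<in> ring_hom R S \<and>
     (\<forall>(T :: 'c ring) \<rho>1 \<rho>2. ring T \<longrightarrow> \<rho>1 \<in> ring_hom S T \<longrightarrow> \<rho>2 \<in> ring_hom S T \<longrightarrow>
        (\<forall>x\<in>carrier R. \<rho>1 (f x) = \<rho>2 (f x)) \<longrightarrow> (\<forall>y\<in>carrier S. \<rho>1 y = \<rho>2 y))"

text \<open>A representation of total dimension n is given in a fixed basis of k^n:
  blk i is the vertex whose space contains basis vector i, and F a is the n\<times>n matrix
  of \<phi>_a, supported in (rows of M_{t(a)}, columns of M_{s(a)}).\<close>

definition mat_mult :: "nat \<Rightarrow> (nat \<Rightarrow> nat \<Rightarrow> 'k::field) \<Rightarrow> (nat \<Rightarrow> nat \<Rightarrow> 'k) \<Rightarrow> nat \<Rightarrow> nat \<Rightarrow> 'k" where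
  "mat_mult n A B = (\<lambda>i j. if i < n \<and> j < n then \<Sum>l<n. A i l * B l j else 0)"

definition mat_vec :: "nat \<Rightarrow> (nat \<Rightarrow> nat \<Rightarrow> 'k::field) \<Rightarrow> (nat \<Rightarrow> 'k) \<Rightarrow> nat \<Rightarrow> 'k" where
  "mat_vec n A x = (\<lambda>i. if i < n then \<Sum>j<n. A i j * x j else 0)"

definition scalar_mat :: "nat \<Rightarrow> 'k::field \<Rightarrow> nat \<Rightarrow> nat \<Rightarrow> 'k" where
  "scalar_mat n c = (\<lambda>i j. if i < n \<and> j < n \<and> i = j then c else 0)"

definition coord_span :: "nat set \<Rightarrow> (nat \<Rightarrow> 'k::field) set" where
  "coord_span I = {x. \<forall>i. x i \<noteq> 0 \<longrightarrow> i \<in> I}"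

definition is_rep ::
  "'v set \<Rightarrow> 'a set \<Rightarrow> ('a \<Rightarrow> 'v) \<Rightarrow> ('a \<Rightarrow> 'v) \<Rightarrow> nat \<Rightarrow> (nat \<Rightarrow> 'v)
     \<Rightarrow> ('a \<Rightarrow> nat \<Rightarrow> nat \<Rightarrow> 'k::field) \<Rightarrow> bool" where
  "is_rep Q0 Q1 src tgt n blk F \<longleftrightarrow>
     (\<forall>i<n. blk i \<in> Q0) \<and>
     (\<forall>a\<in>Q1. \<forall>i j. F a i j \<noteq> 0 \<longrightarrow> i < n \<and> j < n \<and> blk i = tgt a \<and> blk j = src a)"

definition rep_End ::
  "'a set \<Rightarrow> nat \<Rightarrow> (nat \<Rightarrow> 'v) \<Rightarrow> ('a \<Rightarrow> nat \<Rightarrow> nat \<Rightarrow> 'k::field) \<Rightarrow> (nat \<Rightarrow> nat \<Rightarrow> 'k) set" where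
  "rep_End A n blk F =
     {\<Theta>. (\<forall>i j. \<Theta> i j \<noteq> 0 \<longrightarrow> i < n \<and> j < n \<and> blk i = blk j) \<and>
          (\<forall>a\<in>A. mat_mult n \<Theta> (F a) = mat_mult n (F a) \<Theta>)}"

text \<open>Brick: the endomorphism ring is k, i.e. the representation is nonzero and every
  endomorphism is a scalar multiple of the identity.\<close>
definition is_brick :: "'a set \<Rightarrow> nat \<Rightarrow> (nat \<Rightarrow> 'v) \<Rightarrow> ('a \<Rightarrow> nat \<Rightarrow> nat \<Rightarrow> 'k::field) \<Rightarrow> bool" where
  "is_brick A n blk F \<longleftrightarrow> n > 0 \<and> (\<forall>\<Theta>\<in>rep_End A n blk F. \<exists>c. \<Theta> = scalar_mat n c)"

definition vertex_idem :: "nat \<Rightarrow> (nat \<Rightarrow> 'v) \<Rightarrow> 'v \<Rightarrow> nat \<Rightarrow> nat \<Rightarrow> 'k::field" where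
  "vertex_idem n blk v = (\<lambda>i j. if i < n \<and> j < n \<and> i = j \<and> blk i = v then 1 else 0)"

definition path_mat ::
  "nat \<Rightarrow> (nat \<Rightarrow> 'v) \<Rightarrow> ('a \<Rightarrow> nat \<Rightarrow> nat \<Rightarrow> 'k::field) \<Rightarrow> 'v \<times> 'a list \<Rightarrow> nat \<Rightarrow> nat \<Rightarrow> 'k" where
  "path_mat n blk F p =
     (if snd p = [] then vertex_idem n blk (fst p)
      else foldr (\<lambda>a M. mat_mult n (F a) M) (butlast (snd p)) (F (last (snd p))))"

definition action_hom ::
  "nat \<Rightarrow> (nat \<Rightarrow> 'v) \<Rightarrow> ('a \<Rightarrow> nat \<Rightarrow> nat \<Rightarrow> 'k::field) \<Rightarrow> (('v \<times> 'a list) \<Rightarrow> 'k)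
     \<Rightarrow> nat \<Rightarrow> nat \<Rightarrow> 'k" where
  "action_hom n blk F x =
     (\<lambda>i j. \<Sum>p\<in>{p. x p \<noteq> 0}. x p * path_mat n blk F p i j)"

definition const_mat :: "(nat \<Rightarrow> nat \<Rightarrow> 'k::field) \<Rightarrow> nat \<Rightarrow> nat \<Rightarrow> 'x list \<Rightarrow> 'k" where
  "const_mat A = (\<lambda>i j. nc_const (A i j))"

text \<open>Basis layout: indices [0,ds) span M_s, with [0,ks) spanning Ker \<phi>_{e'} and [ks,ds)
  spanning M'_s; indices [ds,ds+dt) span M_t, with [ds,ds+r) spanning Im \<phi>_{e'} and
  [ds+r,ds+dt) spanning M'_t. The indeterminate in matrix position (i,j) is nc_var (i,j);
  hence distinct entries carry distinct indeterminates.\<close>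

definition X11 :: "nat \<Rightarrow> nat \<Rightarrow> nat \<Rightarrow> (nat \<times> nat) set" where
  "X11 ks ds r = {ds..<ds+r} \<times> {0..<ks}"

definition X21 :: "nat \<Rightarrow> nat \<Rightarrow> nat \<Rightarrow> nat \<Rightarrow> (nat \<times> nat) set" where
  "X21 ks ds dt r = {ds+r..<ds+dt} \<times> {0..<ks}"

definition X22 :: "nat \<Rightarrow> nat \<Rightarrow> nat \<Rightarrow> nat \<Rightarrow> (nat \<times> nat) set" where
  "X22 ks ds dt r = {ds+r..<ds+dt} \<times> {ks..<ds}"

definition var_set :: "bool \<Rightarrow> bool \<Rightarrow> nat \<Rightarrow> nat \<Rightarrow> nat \<Rightarrow> nat \<Rightarrow> (nat \<times> nat) set" where
  "var_set b11 b22 ks ds dt r =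
     X21 ks ds dt r \<union> (if b11 then X11 ks ds r else {}) \<union> (if b22 then X22 ks ds dt r else {})"

definition fe_matrix ::
  "bool \<Rightarrow> bool \<Rightarrow> nat \<Rightarrow> nat \<Rightarrow> nat \<Rightarrow> nat \<Rightarrow> (nat \<Rightarrow> nat \<Rightarrow> 'k::field)
     \<Rightarrow> nat \<Rightarrow> nat \<Rightarrow> (nat \<times> nat) list \<Rightarrow> 'k" where
  "fe_matrix b11 b22 ks ds dt r Phi =
     (\<lambda>i j. if (i, j) \<in> var_set b11 b22 ks ds dt r then nc_var (i, j)
            else if (i, j) \<in> {ds..<ds+r} \<times> {ks..<ds} then nc_const (Phi i j)
            else nc_const 0)"


definition ker_arrow :: "nat \<Rightarrow> (nat \<Rightarrow> nat \<Rightarrow> 'k::field) \<Rightarrow> nat \<Rightarrow> (nat \<Rightarrow> 'k) set" where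
  "ker_arrow n A ds = {x \<in> coord_span {..<ds}. mat_vec n A x = (\<lambda>_. 0)}"

definition im_arrow :: "nat \<Rightarrow> (nat \<Rightarrow> nat \<Rightarrow> 'k::field) \<Rightarrow> nat \<Rightarrow> (nat \<Rightarrow> 'k) set" where
  "im_arrow n A ds = mat_vec n A ` coord_span {..<ds}"

end

theory Submission
  imports Defs
begin

text \<open>Suppose two ring homomorphisms agree on the image of \<open>kQ'\<close>. Their common target is
  a bimodule over the matrix ring, hence a matrix bimodule, and its unit is a matrix
  \<open>m\<close> that commutes with the image of \<open>kQ'\<close>. The entries of \<open>m\<close> lie in a
  \<open>k\<close>-vector space, so by duality a linear relation holds for the entries of \<open>m\<close> as soon as it
  holds for those endomorphisms of \<open>M\<close> that satisfy all relations of \<open>m\<close>. The invariance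
  hypotheses make \<open>m\<close> block triangular at \<open>s\<close> and \<open>t\<close>, whence the block of
  \<open>f\<^sub>e m = m f\<^sub>e\<close> containing \<open>\<phi>\<close> is free of indeterminates and says that \<open>m\<close>
  commutes with \<open>\<phi>\<^sub>e\<close>. As \<open>M'\<close> is a brick, \<open>m\<close> is a scalar matrix, so both homomorphisms
  agree on the matrix units; multiplying \<open>f\<^sub>e\<close> by matrix units isolates each indeterminate.\<close>

section \<open>Free algebras and their matrix rings\<close>

text \<open>The common target T is only a ring, so linearity of the two homomorphisms over k has no
  given meaning. In its place, kQ' contains the multiples c of its unit, on which the two
  homomorphisms agree; hence k acts on the corner of T that contains the entries of m, and its left
  and right actions on them coincide. The brick hypothesis concerns matrices over k, whereas m has
  entries in T. The relations between these n^2 entries form a subspace of a finite-dimensional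
  space of coefficient matrices, and such a subspace is determined by its annihilator, which
  consists of matrices over k. The shape of f_e is dictated by the block of f_e m = m f_e with rows
  in Im and columns in M'_s. There X11 is multiplied only by entries of m leading from M'_s to Ker,
  X22 only by entries leading from M'_t to Im, and X21 does not occur. So X11 costs the invariance
  of M'_s and X22 that of M'_t, while X21 is free. In all other blocks the invariance of Ker and Im
  alone annihilates both products with the matrix of e'.\<close>

definition nc_mult :: "('x list \<Rightarrow> 'k::field) \<Rightarrow> ('x list \<Rightarrow> 'k) \<Rightarrow> 'x list \<Rightarrow> 'k" where
  "nc_mult f g = (\<lambda>w. \<Sum>i\<le>length w. f (take i w) * g (drop i w))"

lemma free_algebra_sel:
  "monoid.mult (free_algebra X) = nc_mult"
  "monoid.one (free_algebra X) = nc_const 1"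
  "ring.zero (free_algebra X) = (\<lambda>w. 0)"
  "ring.add (free_algebra X) = (\<lambda>f g w. f w + g w)"
  "carrier (free_algebra X) = {f. finite {w. f w \<noteq> 0} \<and> (\<forall>w. f w \<noteq> 0 \<longrightarrow> set w \<subseteq> X)}"
  by (simp_all add: free_algebra_def nc_mult_def nc_const_def fun_eq_iff)

text \<open>Both sides sum over the ways of cutting \<open>w\<close> into three consecutive pieces,
  that is over cut positions j \<le> i. They differ only in which cut is chosen first.\<close>

lemma nc_mult_assoc: "nc_mult (nc_mult f g) h = nc_mult f (nc_mult g h)"
proof
  fix w :: "'a list"
  let ?n = "length w"
  let ?t = "\<lambda>j i. f (take j w) * g (take (i - j) (drop j w)) * h (drop i w)"
  have "nc_mult (nc_mult f g) h w = (\<Sum>i\<le>?n. \<Sum>j\<le>i. ?t j i)"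
    by (auto simp: nc_mult_def sum_distrib_right drop_take min_def intro!: sum.cong)
  also have "\<dots> = (\<Sum>j\<le>?n. \<Sum>i=j..?n. ?t j i)"
    by (simp add: sum.Sigma)
       (rule sum.reindex_bij_witness[of _ "\<lambda>(j,i). (i,j)" "\<lambda>(i,j). (j,i)"], auto)
  also have "\<dots> = (\<Sum>j\<le>?n. \<Sum>i\<le>?n - j. ?t j (i + j))"
  proof (rule sum.cong[OF refl])
    fix j assume "j \<in> {..?n}"
    then show "(\<Sum>i=j..?n. ?t j i) = (\<Sum>i\<le>?n - j. ?t j (i + j))"
      by (intro sum.reindex_bij_witness[of _ "\<lambda>i. i + j" "\<lambda>i. i - j"]) auto
  qed
  also have "\<dots> = nc_mult f (nc_mult g h) w"
    by (auto simp: nc_mult_def sum_distrib_left mult.assoc intro!: sum.cong)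
  finally show "nc_mult (nc_mult f g) h w = nc_mult f (nc_mult g h) w" .
qed

lemma nc_mult_zero [simp]: "nc_mult (\<lambda>w. 0) g = (\<lambda>w. 0)" "nc_mult f (\<lambda>w. 0) = (\<lambda>w. 0)"
  by (auto simp: nc_mult_def)

lemma nc_const_zero [simp]: "nc_const 0 = (\<lambda>w. 0)"
  by (auto simp: nc_const_def)

lemma nc_mult_const_left: "nc_mult (nc_const c) g = (\<lambda>w. c * g w)"
proof
  fix w
  have "nc_mult (nc_const c) g w = (\<Sum>i\<le>length w. if i = 0 then c * g w else 0)"
    unfolding nc_mult_def nc_const_def by (intro sum.cong) auto
  then show "nc_mult (nc_const c) g w = c * g w" by simp
qed

lemma nc_mult_const_right: "nc_mult g (nc_const c) = (\<lambda>w. g w * c)"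
proof
  fix w
  have "nc_mult g (nc_const c) w = (\<Sum>i\<le>length w. if i = length w then g w * c else 0)"
    unfolding nc_mult_def nc_const_def by (intro sum.cong) auto
  then show "nc_mult g (nc_const c) w = g w * c" by simp
qed

lemma nc_mult_const_const: "nc_mult (nc_const a) (nc_const b) = nc_const (a * b)"
  by (simp add: nc_mult_const_left) (auto simp: nc_const_def)

lemma nc_mult_sum_left: "nc_mult (\<lambda>w. \<Sum>i\<in>I. c i * f i w) g = (\<lambda>w. \<Sum>i\<in>I. c i * nc_mult (f i) g w)"
proof
  fix w
  have "nc_mult (\<lambda>w. \<Sum>i\<in>I. c i * f i w) g w
      = (\<Sum>j\<le>length w. \<Sum>i\<in>I. c i * (f i (take j w) * g (drop j w)))"
    by (simp add: nc_mult_def sum_distrib_right mult.assoc)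
  also have "\<dots> = (\<Sum>i\<in>I. c i * nc_mult (f i) g w)"
    by (subst sum.swap) (simp add: nc_mult_def sum_distrib_left)
  finally show "nc_mult (\<lambda>w. \<Sum>i\<in>I. c i * f i w) g w = (\<Sum>i\<in>I. c i * nc_mult (f i) g w)" .
qed

lemma nc_mult_sum_right: "nc_mult f (\<lambda>w. \<Sum>i\<in>I. c i * g i w) = (\<lambda>w. \<Sum>i\<in>I. c i * nc_mult f (g i) w)"
proof
  fix w
  have "nc_mult f (\<lambda>w. \<Sum>i\<in>I. c i * g i w) w
      = (\<Sum>j\<le>length w. \<Sum>i\<in>I. c i * (f (take j w) * g i (drop j w)))"
    by (simp add: nc_mult_def sum_distrib_left mult_ac)
  also have "\<dots> = (\<Sum>i\<in>I. c i * nc_mult f (g i) w)"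
    by (subst sum.swap) (simp add: nc_mult_def sum_distrib_left)
  finally show "nc_mult f (\<lambda>w. \<Sum>i\<in>I. c i * g i w) w = (\<Sum>i\<in>I. c i * nc_mult f (g i) w)" .
qed

text \<open>Only the cut after \<open>length u\<close> letters can contribute. This is what later
  builds every word out of single indeterminates.\<close>

lemma nc_mult_monomial:
  "nc_mult (\<lambda>w. if w = u then a else 0) (\<lambda>w. if w = v then b else 0)
    = (\<lambda>w. if w = u @ v then a * b else 0)"
proof
  fix w
  have "nc_mult (\<lambda>w. if w = u then a else 0) (\<lambda>w. if w = v then b else 0) w
    = (\<Sum>i\<le>length w. if i = length u then (if w = u @ v then a * b else 0) else 0)"
    unfolding nc_mult_def
  proof (intro sum.cong refl)
    fix i assume i: "i \<in> {..length w}"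
    have "take i w = u \<and> drop i w = v \<longleftrightarrow> i = length u \<and> w = u @ v"
      using i by (auto simp: append_eq_conv_conj)
    moreover have "(if take i w = u then a else 0) * (if drop i w = v then b else 0)
      = (if take i w = u \<and> drop i w = v then a * b else 0)" by simp
    ultimately show "(if take i w = u then a else 0) * (if drop i w = v then b else 0)
      = (if i = length u then (if w = u @ v then a * b else 0) else 0)" by simp
  qed
  then show "nc_mult (\<lambda>w. if w = u then a else 0) (\<lambda>w. if w = v then b else 0) w
    = (if w = u @ v then a * b else 0)" by simp
qed

lemma zero_in_free_algebra: "(\<lambda>w. 0) \<in> carrier (free_algebra X)"
  by (simp add: free_algebra_sel)

lemma nc_const_in_free_algebra: "nc_const c \<in> carrier (free_algebra X)"
  by (auto simp: free_algebra_sel nc_const_def if_distrib split: if_splits)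

lemma nc_var_in_free_algebra: "x \<in> X \<Longrightarrow> nc_var x \<in> carrier (free_algebra X)"
  by (auto simp: free_algebra_sel nc_var_def split: if_splits)

lemma nc_mult_in_free_algebra:
  assumes "f \<in> carrier (free_algebra X)" "g \<in> carrier (free_algebra X)"
  shows "nc_mult f g \<in> carrier (free_algebra X)"
proof -
  have *: "\<exists>u v. w = u @ v \<and> f u \<noteq> 0 \<and> g v \<noteq> 0" if "nc_mult f g w \<noteq> 0" for w
  proof -
    obtain i where "f (take i w) * g (drop i w) \<noteq> 0"
      using \<open>nc_mult f g w \<noteq> 0\<close> unfolding nc_mult_def by (meson sum.not_neutral_contains_not_neutral)
    then show ?thesis by (intro exI[of _ "take i w"] exI[of _ "drop i w"]) auto
  qed
  have "{w. nc_mult f g w \<noteq> 0} \<subseteq> (\<lambda>(u,v). u @ v) ` ({u. f u \<noteq> 0} \<times> {v. g v \<noteq> 0})"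
    using * by force
  then have "finite {w. nc_mult f g w \<noteq> 0}"
    using assms by (auto simp: free_algebra_sel intro: finite_subset)
  then show ?thesis using * assms by (fastforce simp: free_algebra_sel)
qed

lemma lincomb_in_free_algebra:
  assumes "finite I" "\<And>i. i \<in> I \<Longrightarrow> f i \<in> carrier (free_algebra X)"
  shows "(\<lambda>w. \<Sum>i\<in>I. c i * f i w) \<in> carrier (free_algebra X)"
proof -
  have *: "\<exists>i\<in>I. f i w \<noteq> 0" if "(\<Sum>i\<in>I. c i * f i w) \<noteq> 0" for w
    using that by (metis (no_types, lifting) mult_zero_right sum.neutral)
  have "{w. (\<Sum>i\<in>I. c i * f i w) \<noteq> 0} \<subseteq> (\<Union>i\<in>I. {w. f i w \<noteq> 0})" using * by auto
  then have "finite {w. (\<Sum>i\<in>I. c i * f i w) \<noteq> 0}"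
    using assms by (auto simp: free_algebra_sel intro: finite_subset)
  then show ?thesis using * assms(2) by (fastforce simp: free_algebra_sel)
qed

lemma sum_in_free_algebra:
  assumes "finite I" "\<And>i. i \<in> I \<Longrightarrow> f i \<in> carrier (free_algebra X)"
  shows "(\<lambda>w. \<Sum>i\<in>I. f i w) \<in> carrier (free_algebra X)"
  using lincomb_in_free_algebra[OF assms, where c = "\<lambda>_. 1"] by simp

lemma abelian_monoid_free_algebra: "abelian_monoid (free_algebra X)"
proof (rule abelian_monoidI)
  fix f g :: "'a list \<Rightarrow> 'b"
  assume "f \<in> carrier (free_algebra X)" "g \<in> carrier (free_algebra X)"
  \<comment> \<open>A sum of two elements is a sum indexed by the booleans, so closure under finite
    sums already covers addition.\<close>
  then have "(\<lambda>w. \<Sum>b\<in>UNIV. (if b then f else g) w) \<in> carrier (free_algebra X)"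
    by (intro sum_in_free_algebra) auto
  then show "f \<oplus>\<^bsub>free_algebra X\<^esub> g \<in> carrier (free_algebra X)"
    by (simp add: free_algebra_sel(4) UNIV_bool add.commute)
qed (auto simp: free_algebra_sel add_ac)

lemma finsum_free_algebra:
  assumes "finite I" "\<And>i. i \<in> I \<Longrightarrow> f i \<in> carrier (free_algebra X)"
  shows "finsum (free_algebra X) f I = (\<lambda>w. \<Sum>i\<in>I. f i w)"
proof -
  interpret abelian_monoid "free_algebra X" by (rule abelian_monoid_free_algebra)
  show ?thesis using assms
  proof (induction I rule: finite_induct)
    case empty
    then show ?case by (simp add: free_algebra_sel)
  next
    case (insert a I)
    then have "finsum (free_algebra X) f (insert a I)
        = f a \<oplus>\<^bsub>free_algebra X\<^esub> finsum (free_algebra X) f I"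
      by (intro finsum_insert) auto
    with insert show ?case by (simp add: free_algebra_sel(4))
  qed
qed

text \<open>Pointwise sums stand in for \<open>finsum\<close>, so associativity and linearity hold
  for arbitrary functions without carrier conditions. On the carrier this is the product of the
  matrix ring.\<close>

definition nc_mat_mult ::
  "nat \<Rightarrow> (nat \<Rightarrow> nat \<Rightarrow> 'x list \<Rightarrow> 'k::field) \<Rightarrow> (nat \<Rightarrow> nat \<Rightarrow> 'x list \<Rightarrow> 'k)
    \<Rightarrow> nat \<Rightarrow> nat \<Rightarrow> 'x list \<Rightarrow> 'k" where
  "nc_mat_mult n A B =
     (\<lambda>i j. if i < n \<and> j < n then (\<lambda>w. \<Sum>l<n. nc_mult (A i l) (B l j) w) else (\<lambda>w. 0))"

abbreviation (input) free_matrix_ring :: "nat \<Rightarrow> 'x set \<Rightarrow> (nat \<Rightarrow> nat \<Rightarrow> 'x list \<Rightarrow> 'k::field) ring" where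
  "free_matrix_ring n X \<equiv> matrix_ring n (free_algebra X)"

text \<open>Entries outside the n by n square are zero, and zero lies in the free algebra, so
  membership of entries can be stated uniformly in all indices.\<close>

lemma free_matrix_ring_carrier:
  "A \<in> carrier (free_matrix_ring n X) \<longleftrightarrow>
    (\<forall>i j. A i j \<in> carrier (free_algebra X) \<and> (\<not> (i < n \<and> j < n) \<longrightarrow> A i j = (\<lambda>w. 0)))"
  by (auto simp: matrix_ring_def free_algebra_sel(3)) (metis zero_in_free_algebra)

lemma free_matrix_ring_add:
  assumes "A \<in> carrier (free_matrix_ring n X)" "B \<in> carrier (free_matrix_ring n X)"
  shows "A \<oplus>\<^bsub>free_matrix_ring n X\<^esub> B = (\<lambda>i j w. A i j w + B i j w)"
  using assms unfolding free_matrix_ring_carrier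
  by (auto simp: matrix_ring_def free_algebra_sel(3,4) fun_eq_iff)

lemma free_matrix_ring_mult:
  assumes "A \<in> carrier (free_matrix_ring n X)" "B \<in> carrier (free_matrix_ring n X)"
  shows "A \<otimes>\<^bsub>free_matrix_ring n X\<^esub> B = nc_mat_mult n A B"
proof -
  have "finsum (free_algebra X) (\<lambda>l. nc_mult (A i l) (B l j)) {..<n}
      = (\<lambda>w. \<Sum>l<n. nc_mult (A i l) (B l j) w)" for i j
    using assms unfolding free_matrix_ring_carrier
    by (intro finsum_free_algebra) (auto intro: nc_mult_in_free_algebra)
  then show ?thesis
    by (simp add: matrix_ring_def free_algebra_sel(1,3) nc_mat_mult_def fun_eq_iff)
qed

lemma free_matrix_ring_one: "\<one>\<^bsub>free_matrix_ring n X\<^esub> = const_mat (scalar_mat n 1)"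
  by (auto simp: matrix_ring_def const_mat_def scalar_mat_def free_algebra_sel(2,3) fun_eq_iff)

lemma nc_mat_mult_closed:
  assumes "A \<in> carrier (free_matrix_ring n X)" "B \<in> carrier (free_matrix_ring n X)"
  shows "nc_mat_mult n A B \<in> carrier (free_matrix_ring n X)"
  using assms unfolding free_matrix_ring_carrier nc_mat_mult_def
  by (auto intro!: sum_in_free_algebra nc_mult_in_free_algebra zero_in_free_algebra)

lemma lincomb_in_free_matrix_ring:
  assumes "finite I" "\<And>p. p \<in> I \<Longrightarrow> f p \<in> carrier (free_matrix_ring n X)"
  shows "(\<lambda>i j w. \<Sum>p\<in>I. c p * f p i j w) \<in> carrier (free_matrix_ring n X)"
  using assms unfolding free_matrix_ring_carrier
  by (auto intro!: lincomb_in_free_algebra)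

lemma sum_in_free_matrix_ring:
  assumes "finite I" "\<And>p. p \<in> I \<Longrightarrow> f p \<in> carrier (free_matrix_ring n X)"
  shows "(\<lambda>i j w. \<Sum>p\<in>I. f p i j w) \<in> carrier (free_matrix_ring n X)"
  using lincomb_in_free_matrix_ring[OF assms, where c = "\<lambda>_. 1"] by simp

lemma const_mat_in_free_matrix_ring:
  assumes "\<And>i j. A i j \<noteq> 0 \<Longrightarrow> i < n \<and> j < n"
  shows "const_mat A \<in> carrier (free_matrix_ring n X)"
  unfolding free_matrix_ring_carrier const_mat_def
  using assms by (auto simp: nc_const_in_free_algebra) (metis nc_const_zero)+

lemma nc_mat_mult_lincomb_left:
  "nc_mat_mult n (\<lambda>i j w. \<Sum>p\<in>I. c p * f p i j w) B
    = (\<lambda>i j w. \<Sum>p\<in>I. c p * nc_mat_mult n (f p) B i j w)"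
proof (intro ext)
  fix i j w
  have "(\<Sum>l<n. \<Sum>p\<in>I. c p * nc_mult (f p i l) (B l j) w)
      = (\<Sum>p\<in>I. c p * (\<Sum>l<n. nc_mult (f p i l) (B l j) w))"
    by (subst sum.swap) (simp add: sum_distrib_left)
  then show "nc_mat_mult n (\<lambda>i j w. \<Sum>p\<in>I. c p * f p i j w) B i j w
      = (\<Sum>p\<in>I. c p * nc_mat_mult n (f p) B i j w)"
    by (cases "i < n \<and> j < n") (auto simp: nc_mat_mult_def nc_mult_sum_left)
qed

lemma nc_mat_mult_lincomb_right:
  "nc_mat_mult n A (\<lambda>i j w. \<Sum>p\<in>I. c p * f p i j w)
    = (\<lambda>i j w. \<Sum>p\<in>I. c p * nc_mat_mult n A (f p) i j w)"
proof (intro ext)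
  fix i j w
  have "(\<Sum>l<n. \<Sum>p\<in>I. c p * nc_mult (A i l) (f p l j) w)
      = (\<Sum>p\<in>I. c p * (\<Sum>l<n. nc_mult (A i l) (f p l j) w))"
    by (subst sum.swap) (simp add: sum_distrib_left)
  then show "nc_mat_mult n A (\<lambda>i j w. \<Sum>p\<in>I. c p * f p i j w) i j w
      = (\<Sum>p\<in>I. c p * nc_mat_mult n A (f p) i j w)"
    by (cases "i < n \<and> j < n") (auto simp: nc_mat_mult_def nc_mult_sum_right)
qed

lemma nc_mat_mult_assoc:
  "nc_mat_mult n (nc_mat_mult n A B) C = nc_mat_mult n A (nc_mat_mult n B C)"
proof (intro ext)
  fix i j w
  have 1: "nc_mult (\<lambda>w. \<Sum>l<n. nc_mult (A i l) (B l m) w) (C m j)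
      = (\<lambda>w. \<Sum>l<n. nc_mult (A i l) (nc_mult (B l m) (C m j)) w)" for m
    using nc_mult_sum_left[where c = "\<lambda>_. 1" and f = "\<lambda>l. nc_mult (A i l) (B l m)"]
    by (simp add: nc_mult_assoc)
  have 2: "nc_mult (A i l) (\<lambda>w. \<Sum>m<n. nc_mult (B l m) (C m j) w)
      = (\<lambda>w. \<Sum>m<n. nc_mult (A i l) (nc_mult (B l m) (C m j)) w)" for l
    using nc_mult_sum_right[where c = "\<lambda>_. 1" and g = "\<lambda>m. nc_mult (B l m) (C m j)"] by simp
  show "nc_mat_mult n (nc_mat_mult n A B) C i j w = nc_mat_mult n A (nc_mat_mult n B C) i j w"
    by (cases "i < n \<and> j < n") (auto simp: nc_mat_mult_def 1 2 intro: sum.swap)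
qed

lemma const_mat_mult: "nc_mat_mult n (const_mat A) (const_mat B) = const_mat (mat_mult n A B)"
proof (intro ext)
  fix i j w
  show "nc_mat_mult n (const_mat A) (const_mat B) i j w = const_mat (mat_mult n A B) i j w"
    by (auto simp: nc_mat_mult_def const_mat_def mat_mult_def nc_mult_const_const)
      (auto simp: nc_const_def)
qed

lemma nc_mat_mult_vertex_idem_left:
  assumes "\<And>i j. \<not> (i < n \<and> j < n) \<Longrightarrow> A i j = (\<lambda>w. 0)"
  shows "nc_mat_mult n (const_mat (vertex_idem n blk v)) A
    = (\<lambda>i j. if blk i = v then A i j else (\<lambda>w. 0))"
proof (intro ext)
  fix i j w
  have "(\<Sum>l<n. nc_mult (nc_const (vertex_idem n blk v i l)) (A l j) w)
      = (\<Sum>l<n. if l = i then (if blk i = v then A i j w else 0) else 0)" if "i < n"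
    using that by (intro sum.cong) (auto simp: vertex_idem_def nc_mult_const_left)
  then show "nc_mat_mult n (const_mat (vertex_idem n blk v)) A i j w
      = (if blk i = v then A i j else (\<lambda>w. 0)) w"
    using assms by (auto simp: nc_mat_mult_def const_mat_def)
qed

lemma nc_mat_mult_vertex_idem_right:
  assumes "\<And>i j. \<not> (i < n \<and> j < n) \<Longrightarrow> A i j = (\<lambda>w. 0)"
  shows "nc_mat_mult n A (const_mat (vertex_idem n blk v))
    = (\<lambda>i j. if blk j = v then A i j else (\<lambda>w. 0))"
proof (intro ext)
  fix i j w
  have "(\<Sum>l<n. nc_mult (A i l) (nc_const (vertex_idem n blk v l j)) w)
      = (\<Sum>l<n. if l = j then (if blk j = v then A i j w else 0) else 0)" if "j < n"
    using that by (intro sum.cong) (auto simp: vertex_idem_def nc_mult_const_right)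
  then show "nc_mat_mult n A (const_mat (vertex_idem n blk v)) i j w
      = (if blk j = v then A i j else (\<lambda>w. 0)) w"
    using assms by (auto simp: nc_mat_mult_def const_mat_def)
qed

section \<open>Representations of the path algebra over a free algebra\<close>

text \<open>Closing the product with the idempotent of the source vertex treats trivial and
  nontrivial paths alike, unlike \<open>path_mat\<close>, and lets the composability of two paths be
  read off from that idempotent.\<close>

definition nc_path_mat ::
  "nat \<Rightarrow> (nat \<Rightarrow> 'v) \<Rightarrow> ('a \<Rightarrow> nat \<Rightarrow> nat \<Rightarrow> 'x list \<Rightarrow> 'k::field) \<Rightarrow> 'v \<times> 'a list
    \<Rightarrow> nat \<Rightarrow> nat \<Rightarrow> 'x list \<Rightarrow> 'k" where
  "nc_path_mat n blk G p =
     foldr (\<lambda>a M. nc_mat_mult n (G a) M) (snd p) (const_mat (vertex_idem n blk (fst p)))"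

definition nc_action ::
  "nat \<Rightarrow> (nat \<Rightarrow> 'v) \<Rightarrow> ('a \<Rightarrow> nat \<Rightarrow> nat \<Rightarrow> 'x list \<Rightarrow> 'k::field) \<Rightarrow> ('v \<times> 'a list \<Rightarrow> 'k)
    \<Rightarrow> nat \<Rightarrow> nat \<Rightarrow> 'x list \<Rightarrow> 'k" where
  "nc_action n blk G x = (\<lambda>i j w. \<Sum>p\<in>{p. x p \<noteq> 0}. x p * nc_path_mat n blk G p i j w)"

lemma nc_action_superset:
  assumes "finite P" "\<And>p. x p \<noteq> 0 \<Longrightarrow> p \<in> P"
  shows "nc_action n blk G x = (\<lambda>i j w. \<Sum>p\<in>P. x p * nc_path_mat n blk G p i j w)"
  unfolding nc_action_def using assms
  by (intro ext sum.mono_neutral_left) auto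

lemma nc_action_path_elem: "nc_action n blk G (path_elem p) = nc_path_mat n blk G p"
proof -
  have "nc_action n blk G (path_elem p)
      = (\<lambda>i j w. \<Sum>q\<in>{p}. path_elem p q * nc_path_mat n blk G q i j w)"
    by (rule nc_action_superset) (auto simp: path_elem_def split: if_splits)
  then show ?thesis by (simp add: path_elem_def)
qed

lemma nc_path_mat_const:
  assumes rep: "is_rep Q0 Q1 src tgt n blk F" and p: "valid_path Q0 Q1 src tgt p"
    and G: "\<And>a. a \<in> set (snd p) \<Longrightarrow> G a = const_mat (F a)"
  shows "nc_path_mat n blk G p = const_mat (path_mat n blk F p)"
proof (cases "snd p = []")
  case True
  then show ?thesis by (simp add: nc_path_mat_def path_mat_def)
next
  case False
  let ?a = "last (snd p)"
  have a: "?a \<in> Q1" "src ?a = fst p" using p False last_in_set[OF False] by (auto simp: valid_path_def)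
  then have supp: "F ?a i j \<noteq> 0 \<Longrightarrow> i < n \<and> j < n \<and> blk j = fst p" for i j
    using rep by (auto simp: is_rep_def)
  \<comment> \<open>The closing idempotent is absorbed by the matrix of the arrow traversed first,
    whose nonzero columns all belong to the source of the path.\<close>
  have last: "nc_mat_mult n (G ?a) (const_mat (vertex_idem n blk (fst p))) = const_mat (F ?a)"
  proof -
    have "F ?a i j = 0" if "\<not> (i < n \<and> j < n \<and> blk j = fst p)" for i j
      using supp that by blast
    then show ?thesis
      unfolding G[OF last_in_set[OF False]]
      by (subst nc_mat_mult_vertex_idem_right) (auto simp: const_mat_def fun_eq_iff)
  qed
  have fold: "foldr (\<lambda>a M. nc_mat_mult n (G a) M) as (const_mat N)
      = const_mat (foldr (\<lambda>a M. mat_mult n (F a) M) as N)" if "set as \<subseteq> set (snd p)" for as N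
    using that by (induction as) (auto simp: G const_mat_mult)
  have "nc_path_mat n blk G p
      = foldr (\<lambda>a M. nc_mat_mult n (G a) M) (butlast (snd p) @ [?a]) (const_mat (vertex_idem n blk (fst p)))"
    using False by (simp add: nc_path_mat_def)
  also have "\<dots> = const_mat (foldr (\<lambda>a M. mat_mult n (F a) M) (butlast (snd p)) (F ?a))"
    by (simp only: foldr_append foldr_Cons foldr_Nil comp_def id_def last)
      (rule fold, auto dest: in_set_butlastD)
  finally show ?thesis using False by (simp add: path_mat_def)
qed

lemma nc_action_const:
  assumes rep: "is_rep Q0 Q1 src tgt n blk F"
    and x: "x \<in> carrier (path_algebra Q0 Q1 src tgt)"
    and G: "\<And>a. a \<in> Q1 \<Longrightarrow> G a = const_mat (F a)"
  shows "nc_action n blk G x = const_mat (action_hom n blk F x)"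
proof -
  have "nc_path_mat n blk G p = const_mat (path_mat n blk F p)" if "x p \<noteq> 0" for p
  proof -
    have p: "valid_path Q0 Q1 src tgt p" using x that by (cases p) (auto simp: path_algebra_def)
    then show ?thesis by (intro nc_path_mat_const[OF rep p] G) (auto simp: valid_path_def)
  qed
  then have "nc_action n blk G x
      = (\<lambda>i j w. \<Sum>p\<in>{p. x p \<noteq> 0}. x p * nc_const (path_mat n blk F p i j) w)"
    unfolding nc_action_def by (intro ext sum.cong) (auto simp: const_mat_def)
  also have "\<dots> = const_mat (action_hom n blk F x)"
    by (auto simp: const_mat_def action_hom_def nc_const_def fun_eq_iff)
  finally show ?thesis .
qed

lemma path_elem_in:
  "valid_path Q0 Q1 src tgt p \<Longrightarrow> path_elem p \<in> carrier (path_algebra Q0 Q1 src tgt)"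
  by (auto simp: path_elem_def path_algebra_def split: if_splits)

text \<open>The analogue of \<open>is_rep\<close> with noncommutative polynomials as matrix entries.
  Arrows generate the path algebra with no relations beyond the support conditions, so any such
  \<open>G\<close> yields a homomorphism; this is how f is constructed.\<close>

locale nc_rep =
  fixes Q0 :: "'v set" and Q1 :: "'a set" and src tgt :: "'a \<Rightarrow> 'v"
    and n :: nat and blk :: "nat \<Rightarrow> 'v" and X :: "'x set"
    and G :: "'a \<Rightarrow> nat \<Rightarrow> nat \<Rightarrow> 'x list \<Rightarrow> 'k::field"
  assumes fin: "finite_quiver Q0 Q1 src tgt"
    and blk_in: "\<And>i. i < n \<Longrightarrow> blk i \<in> Q0"
    and G_in: "\<And>a. a \<in> Q1 \<Longrightarrow> G a \<in> carrier (free_matrix_ring n X)"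
    and G_supp: "\<And>a i j. a \<in> Q1 \<Longrightarrow> G a i j \<noteq> (\<lambda>w. 0) \<Longrightarrow> blk i = tgt a \<and> blk j = src a"
begin

lemma vertex_idem_in: "const_mat (vertex_idem n blk v) \<in> carrier (free_matrix_ring n X)"
  by (rule const_mat_in_free_matrix_ring) (auto simp: vertex_idem_def split: if_splits)

lemma foldr_in:
  assumes "set as \<subseteq> Q1" "M \<in> carrier (free_matrix_ring n X)"
  shows "foldr (\<lambda>a M. nc_mat_mult n (G a) M) as M \<in> carrier (free_matrix_ring n X)"
  using assms by (induction as) (auto intro: nc_mat_mult_closed G_in)

lemma foldr_mult:
  "nc_mat_mult n (foldr (\<lambda>a M. nc_mat_mult n (G a) M) as M) N
    = foldr (\<lambda>a M. nc_mat_mult n (G a) M) as (nc_mat_mult n M N)"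
  by (induction as) (simp_all add: nc_mat_mult_assoc)

lemma foldr_zero:
  "foldr (\<lambda>a M. nc_mat_mult n (G a) M) as (\<lambda>i j w. 0) = (\<lambda>i j w. 0)"
proof -
  have "nc_mat_mult n M (\<lambda>i j w. 0) = (\<lambda>i j w. 0)" for M :: "nat \<Rightarrow> nat \<Rightarrow> 'x list \<Rightarrow> 'k"
    by (auto simp: nc_mat_mult_def fun_eq_iff)
  then show ?thesis by (induction as) simp_all
qed

lemma nc_path_mat_in:
  "valid_path Q0 Q1 src tgt p \<Longrightarrow> nc_path_mat n blk G p \<in> carrier (free_matrix_ring n X)"
  unfolding nc_path_mat_def valid_path_def by (intro foldr_in vertex_idem_in) auto

lemma nc_path_mat_outside:
  assumes "valid_path Q0 Q1 src tgt p" "\<not> (i < n \<and> j < n)"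
  shows "nc_path_mat n blk G p i j = (\<lambda>w. 0)"
  using nc_path_mat_in[OF assms(1)] assms(2) unfolding free_matrix_ring_carrier by blast

lemma nc_path_mat_row_supp:
  assumes "valid_path Q0 Q1 src tgt p" "blk i \<noteq> path_tgt tgt p"
  shows "nc_path_mat n blk G p i j = (\<lambda>w. 0)"
proof (cases "snd p")
  case Nil
  then show ?thesis using assms
    by (auto simp: nc_path_mat_def path_tgt_def const_mat_def vertex_idem_def)
next
  case (Cons a as)
  then have "a \<in> Q1" using assms(1) by (auto simp: valid_path_def)
  then have "G a i l = (\<lambda>w. 0)" for l
    using G_supp[of a i l] assms(2) Cons by (auto simp: path_tgt_def)
  then show ?thesis by (simp add: nc_path_mat_def Cons nc_mat_mult_def)
qed

text \<open>The idempotent closing the matrix of \<open>p\<close> keeps the rows at the source of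
  \<open>p\<close>, while the matrix of \<open>q\<close> has nonzero rows only at the target of
  \<open>q\<close>. So the idempotent acts on it either as the identity or as zero.\<close>

lemma nc_path_mat_mult:
  assumes p: "valid_path Q0 Q1 src tgt p" and q: "valid_path Q0 Q1 src tgt q"
  shows "nc_mat_mult n (nc_path_mat n blk G p) (nc_path_mat n blk G q)
    = (if path_src p = path_tgt tgt q then nc_path_mat n blk G (fst q, snd p @ snd q)
       else (\<lambda>i j w. 0))"
proof -
  have idem: "nc_mat_mult n (const_mat (vertex_idem n blk (fst p))) (nc_path_mat n blk G q)
     = (\<lambda>i j. if blk i = fst p then nc_path_mat n blk G q i j else (\<lambda>w. 0))"
    using nc_path_mat_outside[OF q] by (intro nc_mat_mult_vertex_idem_left) auto
  have eq: "nc_mat_mult n (nc_path_mat n blk G p) (nc_path_mat n blk G q)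
    = foldr (\<lambda>a M. nc_mat_mult n (G a) M) (snd p)
       (\<lambda>i j. if blk i = fst p then nc_path_mat n blk G q i j else (\<lambda>w. 0))"
    unfolding idem[symmetric] by (simp add: nc_path_mat_def foldr_mult)
  show ?thesis
  proof (cases "path_src p = path_tgt tgt q")
    case True
    then have "(\<lambda>i j. if blk i = fst p then nc_path_mat n blk G q i j else (\<lambda>w. 0))
      = nc_path_mat n blk G q"
      using nc_path_mat_row_supp[OF q] by (auto simp: path_src_def fun_eq_iff)
    then show ?thesis using True by (simp add: eq) (simp add: nc_path_mat_def)
  next
    case False
    then have "(\<lambda>i j. if blk i = fst p then nc_path_mat n blk G q i j else (\<lambda>w. 0))
      = (\<lambda>i j w. 0)"
      using nc_path_mat_row_supp[OF q] by (auto simp: path_src_def fun_eq_iff)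
    then show ?thesis using False by (simp add: eq foldr_zero)
  qed
qed

lemma nc_path_mat_arrow:
  assumes "a \<in> Q1"
  shows "nc_path_mat n blk G (src a, [a]) = G a"
proof -
  have "nc_mat_mult n (G a) (const_mat (vertex_idem n blk (src a)))
    = (\<lambda>i j. if blk j = src a then G a i j else (\<lambda>w. 0))"
    using G_in[OF assms] unfolding free_matrix_ring_carrier
    by (intro nc_mat_mult_vertex_idem_right) auto
  also have "\<dots> = G a" using G_supp[OF assms] by (auto simp: fun_eq_iff)
  finally show ?thesis by (simp add: nc_path_mat_def)
qed

text \<open>The argument is c times the unit of the path algebra, a sum of trivial paths over all
  vertices; position (i, i) receives a contribution from \<open>blk i\<close> alone. The case c = 1
  gives preservation of the unit, the general case gives agreement on scalars.\<close>

lemma nc_action_scalar: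
  "nc_action n blk G (\<lambda>p. if snd p = [] \<and> fst p \<in> Q0 then c else 0) = const_mat (scalar_mat n c)"
proof -
  have fQ: "finite ((\<lambda>v. (v, [])) ` Q0 :: ('v \<times> 'a list) set)"
    using fin by (auto simp: finite_quiver_def)
  have "nc_action n blk G (\<lambda>p. if snd p = [] \<and> fst p \<in> Q0 then c else 0)
      = (\<lambda>i j w. \<Sum>v\<in>Q0. c * nc_const (vertex_idem n blk v i j) w)"
    by (subst nc_action_superset[OF fQ])
      (auto simp: sum.reindex inj_on_def nc_path_mat_def const_mat_def split: if_splits)
  also have "\<dots> = const_mat (scalar_mat n c)"
  proof (intro ext)
    fix i j and w :: "'x list"
    have "(\<Sum>v\<in>Q0. c * nc_const (vertex_idem n blk v i j) w)
      = (\<Sum>v\<in>Q0. if v = blk i then nc_const (scalar_mat n c i j) w else 0)"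
      by (intro sum.cong) (auto simp: vertex_idem_def scalar_mat_def nc_const_def)
    then show "(\<Sum>v\<in>Q0. c * nc_const (vertex_idem n blk v i j) w)
        = const_mat (scalar_mat n c) i j w"
      using blk_in[of i] fin
      by (auto simp: finite_quiver_def const_mat_def scalar_mat_def)
  qed
  finally show ?thesis .
qed

lemma nc_action_hom:
  "nc_action n blk G \<in> ring_hom (path_algebra Q0 Q1 src tgt) (free_matrix_ring n X)"
proof (rule ring_hom_memI)
  let ?R = "path_algebra Q0 Q1 src tgt :: ('v \<times> 'a list \<Rightarrow> 'k) ring"
  let ?N = "nc_path_mat n blk G"
  have carr: "finite {p. x p \<noteq> 0}" "\<And>p. x p \<noteq> 0 \<Longrightarrow> valid_path Q0 Q1 src tgt p"
    if "x \<in> carrier ?R" for x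
    using that by (auto simp: path_algebra_def)
  show in_S: "nc_action n blk G x \<in> carrier (free_matrix_ring n X)" if "x \<in> carrier ?R" for x
    unfolding nc_action_def using carr[OF that]
    by (intro lincomb_in_free_matrix_ring nc_path_mat_in) auto
  show "nc_action n blk G (x \<oplus>\<^bsub>?R\<^esub> y)
      = nc_action n blk G x \<oplus>\<^bsub>free_matrix_ring n X\<^esub> nc_action n blk G y"
    if x: "x \<in> carrier ?R" and y: "y \<in> carrier ?R" for x y
  proof -
    let ?P = "{p. x p \<noteq> 0} \<union> {p. y p \<noteq> 0}"
    have fP: "finite ?P" using carr[OF x] carr[OF y] by auto
    have "nc_action n blk G (\<lambda>p. x p + y p)
        = (\<lambda>i j w. (\<Sum>p\<in>?P. x p * ?N p i j w) + (\<Sum>p\<in>?P. y p * ?N p i j w))"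
      by (subst nc_action_superset[OF fP]) (auto simp: sum.distrib distrib_right)
    also have "\<dots> = (\<lambda>i j w. nc_action n blk G x i j w + nc_action n blk G y i j w)"
      by (simp add: nc_action_superset[OF fP, of x] nc_action_superset[OF fP, of y])
    finally show ?thesis
      by (simp add: free_matrix_ring_add[OF in_S[OF x] in_S[OF y]]) (simp add: path_algebra_def)
  qed
  show "nc_action n blk G (x \<otimes>\<^bsub>?R\<^esub> y)
      = nc_action n blk G x \<otimes>\<^bsub>free_matrix_ring n X\<^esub> nc_action n blk G y"
    if x: "x \<in> carrier ?R" and y: "y \<in> carrier ?R" for x y
  proof -
    let ?A = "{p. x p \<noteq> 0}" and ?B = "{q. y q \<noteq> 0}"
    let ?c = "\<lambda>p q. path_src p = path_tgt tgt q" and ?m = "\<lambda>p q. (fst q, snd p @ snd q)"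
    \<comment> \<open>Concatenations of all pairs, composable or not: a finite set containing the
      support of the product, which keeps the range of summation independent of
      composability.\<close>
    let ?P = "(\<lambda>(p,q). ?m p q) ` (?A \<times> ?B)"
    note fx = carr[OF x] and fy = carr[OF y]
    have fP: "finite ?P" using fx fy by auto
    have xy: "x \<otimes>\<^bsub>?R\<^esub> y
        = (\<lambda>w. \<Sum>p\<in>?A. \<Sum>q\<in>?B. if ?c p q \<and> ?m p q = w then x p * y q else 0)"
      by (simp add: path_algebra_def)
    have supp: "w \<in> ?P" if "(x \<otimes>\<^bsub>?R\<^esub> y) w \<noteq> 0" for w
    proof (rule ccontr)
      assume w: "w \<notin> ?P"
      have "(x \<otimes>\<^bsub>?R\<^esub> y) w = 0" unfolding xy
        by (intro sum.neutral ballI) (use w in force)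
      with that show False by simp
    qed
    have "nc_action n blk G (x \<otimes>\<^bsub>?R\<^esub> y) i j w
        = nc_mat_mult n (nc_action n blk G x) (nc_action n blk G y) i j w" for i j w
    proof -
      have "nc_action n blk G (x \<otimes>\<^bsub>?R\<^esub> y) i j w
         = (\<Sum>u\<in>?P. (x \<otimes>\<^bsub>?R\<^esub> y) u * ?N u i j w)"
        by (subst nc_action_superset[OF fP]) (auto dest: supp)
      also have "\<dots> = (\<Sum>u\<in>?P. \<Sum>p\<in>?A. \<Sum>q\<in>?B.
            if ?m p q = u then (if ?c p q then x p * y q * ?N u i j w else 0) else 0)"
        unfolding xy sum_distrib_right by (intro sum.cong refl) auto
      also have "\<dots> = (\<Sum>p\<in>?A. \<Sum>u\<in>?P. \<Sum>q\<in>?B.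
            if ?m p q = u then (if ?c p q then x p * y q * ?N u i j w else 0) else 0)"
        by (rule sum.swap)
      also have "\<dots> = (\<Sum>p\<in>?A. \<Sum>q\<in>?B. \<Sum>u\<in>?P.
            if ?m p q = u then (if ?c p q then x p * y q * ?N u i j w else 0) else 0)"
        by (intro sum.cong refl sum.swap)
      \<comment> \<open>Each pair contributes to exactly one word, and that word belongs to
        \<open>?P\<close>, so the innermost sum collapses.\<close>
      also have "\<dots> = (\<Sum>p\<in>?A. \<Sum>q\<in>?B. if ?c p q then x p * y q * ?N (?m p q) i j w else 0)"
        by (intro sum.cong refl) (use fP in \<open>force simp: sum.delta'\<close>)
      also have "\<dots> = (\<Sum>p\<in>?A. x p * (\<Sum>q\<in>?B. y q * nc_mat_mult n (?N p) (?N q) i j w))"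
        unfolding sum_distrib_left
        by (intro sum.cong refl) (auto simp: nc_path_mat_mult fx fy mult.assoc)
      also have "\<dots> = nc_mat_mult n (nc_action n blk G x) (nc_action n blk G y) i j w"
        unfolding nc_action_def by (simp add: nc_mat_mult_lincomb_left nc_mat_mult_lincomb_right)
      finally show ?thesis .
    qed
    then show ?thesis by (simp add: free_matrix_ring_mult[OF in_S[OF x] in_S[OF y]] fun_eq_iff)
  qed
  show "nc_action n blk G \<one>\<^bsub>?R\<^esub> = \<one>\<^bsub>free_matrix_ring n X\<^esub>"
    using nc_action_scalar[of 1] by (simp add: path_algebra_def free_matrix_ring_one)
qed

end

section \<open>Pairs of homomorphisms out of a matrix ring over a free algebra\<close>

definition unit_mat :: "('x list \<Rightarrow> 'k::field) \<Rightarrow> nat \<Rightarrow> nat \<Rightarrow> nat \<Rightarrow> nat \<Rightarrow> 'x list \<Rightarrow> 'k" where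
  "unit_mat a i j = (\<lambda>p q. if p = i \<and> q = j then a else (\<lambda>w. 0))"

lemma unit_mat_in:
  "a \<in> carrier (free_algebra X) \<Longrightarrow> i < n \<Longrightarrow> j < n \<Longrightarrow> unit_mat a i j \<in> carrier (free_matrix_ring n X)"
  unfolding free_matrix_ring_carrier by (auto simp: unit_mat_def zero_in_free_algebra)

lemma unit_mat_mult_left:
  assumes "i < n" "j < n" "M \<in> carrier (free_matrix_ring n X)"
  shows "nc_mat_mult n (unit_mat a i j) M = (\<lambda>p q. if p = i then nc_mult a (M j q) else (\<lambda>w. 0))"
proof (intro ext)
  fix p q w
  have "(\<Sum>l<n. nc_mult (unit_mat a i j p l) (M l q) w)
      = (\<Sum>l<n. if l = j then (if p = i then nc_mult a (M j q) w else 0) else 0)"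
    by (intro sum.cong) (auto simp: unit_mat_def)
  moreover have "q \<ge> n \<Longrightarrow> M j q = (\<lambda>w. 0)"
    using assms(3) unfolding free_matrix_ring_carrier by auto
  ultimately show "nc_mat_mult n (unit_mat a i j) M p q w
      = (if p = i then nc_mult a (M j q) else (\<lambda>w. 0)) w"
    using assms(1,2) by (cases "q < n") (auto simp: nc_mat_mult_def)
qed

lemma unit_mat_mult_right:
  assumes "i < n" "j < n" "M \<in> carrier (free_matrix_ring n X)"
  shows "nc_mat_mult n M (unit_mat a i j) = (\<lambda>p q. if q = j then nc_mult (M p i) a else (\<lambda>w. 0))"
proof (intro ext)
  fix p q w
  have "(\<Sum>l<n. nc_mult (M p l) (unit_mat a i j l q) w)
      = (\<Sum>l<n. if l = i then (if q = j then nc_mult (M p i) a w else 0) else 0)"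
    by (intro sum.cong) (auto simp: unit_mat_def)
  moreover have "p \<ge> n \<Longrightarrow> M p i = (\<lambda>w. 0)"
    using assms(3) unfolding free_matrix_ring_carrier by auto
  ultimately show "nc_mat_mult n M (unit_mat a i j) p q w
      = (if q = j then nc_mult (M p i) a else (\<lambda>w. 0)) w"
    using assms(1,2) by (cases "p < n") (auto simp: nc_mat_mult_def)
qed

lemma unit_mat_mult:
  assumes "i < n" "j < n" "l < n" "b \<in> carrier (free_algebra X)"
  shows "nc_mat_mult n (unit_mat a i j) (unit_mat b j l) = unit_mat (nc_mult a b) i l"
  using unit_mat_mult_left[OF assms(1,2) unit_mat_in[OF assms(4,2,3)]]
  by (auto simp: unit_mat_def fun_eq_iff)

text \<open>\<open>scalars_agree\<close> takes the place of k-linearity, since T carries no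
  k-algebra structure. Positivity of n supplies the index 0, whose diagonal matrix unit marks the
  corner in which all computations take place.\<close>

locale hom_pair = ring T for T (structure) +
  fixes n :: nat and X :: "'x set"
    and \<rho>\<^sub>1 \<rho>\<^sub>2 :: "(nat \<Rightarrow> nat \<Rightarrow> 'x list \<Rightarrow> 'k::field) \<Rightarrow> 'a"
  assumes n_pos: "0 < n"
    and hom1: "\<rho>\<^sub>1 \<in> ring_hom (free_matrix_ring n X) T"
    and hom2: "\<rho>\<^sub>2 \<in> ring_hom (free_matrix_ring n X) T"
    and scalars_agree: "\<And>c. \<rho>\<^sub>1 (const_mat (scalar_mat n c)) = \<rho>\<^sub>2 (const_mat (scalar_mat n c))"
begin

abbreviation "S \<equiv> free_matrix_ring n X :: (nat \<Rightarrow> nat \<Rightarrow> 'x list \<Rightarrow> 'k) ring"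
abbreviation "A \<equiv> free_algebra X :: ('x list \<Rightarrow> 'k) ring"
abbreviation "E \<equiv> unit_mat (nc_const 1 :: 'x list \<Rightarrow> 'k)"

lemma E_in [simp]: "i < n \<Longrightarrow> j < n \<Longrightarrow> E i j \<in> carrier S"
  by (simp add: unit_mat_in nc_const_in_free_algebra)

lemma hom_closed [simp]:
  "M \<in> carrier S \<Longrightarrow> \<rho>\<^sub>1 M \<in> carrier T" "M \<in> carrier S \<Longrightarrow> \<rho>\<^sub>2 M \<in> carrier T"
  using hom1 hom2 by (auto simp: ring_hom_closed)

lemma hom_mult:
  assumes "h \<in> ring_hom S T" "M \<in> carrier S" "N \<in> carrier S"
  shows "h (nc_mat_mult n M N) = h M \<otimes> h N"
  using ring_hom_mult[OF assms] free_matrix_ring_mult[OF assms(2,3)] by simp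

lemma hom_unit_mult:
  assumes "h \<in> ring_hom S T" "i < n" "j < n" "l < n" "a \<in> carrier A" "b \<in> carrier A"
  shows "h (unit_mat a i j) \<otimes> h (unit_mat b j l) = h (unit_mat (nc_mult a b) i l)"
  using hom_mult[OF assms(1) unit_mat_in unit_mat_in, of a i j b j l] assms
  by (simp add: unit_mat_mult)

lemma hom_zero:
  assumes "h \<in> ring_hom S T"
  shows "h (\<lambda>i j w. 0) = \<zero>"
proof -
  have z: "(\<lambda>i j w. 0) \<in> carrier S"
    unfolding free_matrix_ring_carrier by (auto simp: zero_in_free_algebra)
  have hz: "h (\<lambda>i j w. 0) \<in> carrier T" using ring_hom_closed[OF assms z] .
  have "h (\<lambda>i j w. 0) \<oplus> h (\<lambda>i j w. 0) = h (\<lambda>i j w. 0)"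
    using ring_hom_add[OF assms z z] free_matrix_ring_add[OF z z] by simp
  then show ?thesis using hz by (metis add.r_cancel_one')
qed

lemma hom_sum:
  assumes h: "h \<in> ring_hom S T" and "finite I" "\<And>p. p \<in> I \<Longrightarrow> f p \<in> carrier S"
  shows "h (\<lambda>i j w. \<Sum>p\<in>I. f p i j w) = (\<Oplus>p\<in>I. h (f p))"
  using assms(2,3)
proof (induction I rule: finite_induct)
  case empty
  then show ?case using hom_zero[OF h] by simp
next
  case (insert a I)
  have s: "(\<lambda>i j w. \<Sum>p\<in>I. f p i j w) \<in> carrier S"
    using insert by (intro sum_in_free_matrix_ring) auto
  have "h (\<lambda>i j w. \<Sum>p\<in>insert a I. f p i j w) = h (f a) \<oplus> h (\<lambda>i j w. \<Sum>p\<in>I. f p i j w)"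
    using ring_hom_add[OF h _ s, of "f a"] free_matrix_ring_add[OF _ s, of "f a"] insert
    by simp
  also have "\<dots> = (\<Oplus>p\<in>insert a I. h (f p))"
    using insert ring_hom_closed[OF h] by (subst finsum_insert) auto
  finally show ?case .
qed

text \<open>Multiplying by \<open>E 0 i\<close> moves row i of \<open>M\<close> to row 0, and each
  entry of that row factors through position (0, 0). The entries of \<open>M\<close> thereby act
  inside the corner.\<close>

lemma hom_row:
  assumes h: "h \<in> ring_hom S T" and M: "M \<in> carrier S" and i: "i < n"
  shows "h (E 0 i) \<otimes> h M = (\<Oplus>l\<in>{..<n}. h (unit_mat (M i l) 0 0) \<otimes> h (E 0 l))"
proof -
  have Mil: "M i l \<in> carrier A" "l \<ge> n \<Longrightarrow> M i l = (\<lambda>w. 0)" for l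
    using M unfolding free_matrix_ring_carrier by auto
  have "nc_mat_mult n (E 0 i) M = (\<lambda>p q w. \<Sum>l\<in>{..<n}. unit_mat (M i l) 0 l p q w)"
  proof (intro ext)
    fix p q w
    have "(\<Sum>l\<in>{..<n}. unit_mat (M i l) 0 l p q w)
        = (\<Sum>l\<in>{..<n}. if l = q then (if p = 0 then M i q w else 0) else 0)"
      by (intro sum.cong) (auto simp: unit_mat_def)
    then show "nc_mat_mult n (E 0 i) M p q w = (\<Sum>l\<in>{..<n}. unit_mat (M i l) 0 l p q w)"
      using Mil(2)[of q] by (auto simp: unit_mat_mult_left[OF n_pos i M] nc_mult_const_left)
  qed
  then have "h (E 0 i) \<otimes> h M = (\<Oplus>l\<in>{..<n}. h (unit_mat (M i l) 0 l))"
    using hom_mult[OF h E_in[OF n_pos i] M] hom_sum[OF h, of "{..<n}" "\<lambda>l. unit_mat (M i l) 0 l"]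
    by (simp add: unit_mat_in n_pos Mil)
  also have "\<dots> = (\<Oplus>l\<in>{..<n}. h (unit_mat (M i l) 0 0) \<otimes> h (E 0 l))"
    by (rule finsum_cong')
      (auto simp: hom_unit_mult[OF h] n_pos Mil nc_const_in_free_algebra nc_mult_const_right
        intro!: ring_hom_closed[OF h] unit_mat_in)
  finally show ?thesis .
qed

lemma hom_col:
  assumes h: "h \<in> ring_hom S T" and M: "M \<in> carrier S" and j: "j < n"
  shows "h M \<otimes> h (E j 0) = (\<Oplus>l\<in>{..<n}. h (E l 0) \<otimes> h (unit_mat (M l j) 0 0))"
proof -
  have Mlj: "M l j \<in> carrier A" "l \<ge> n \<Longrightarrow> M l j = (\<lambda>w. 0)" for l
    using M unfolding free_matrix_ring_carrier by auto
  have "nc_mat_mult n M (E j 0) = (\<lambda>p q w. \<Sum>l\<in>{..<n}. unit_mat (M l j) l 0 p q w)"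
  proof (intro ext)
    fix p q w
    have "(\<Sum>l\<in>{..<n}. unit_mat (M l j) l 0 p q w)
        = (\<Sum>l\<in>{..<n}. if l = p then (if q = 0 then M p j w else 0) else 0)"
      by (intro sum.cong) (auto simp: unit_mat_def)
    then show "nc_mat_mult n M (E j 0) p q w = (\<Sum>l\<in>{..<n}. unit_mat (M l j) l 0 p q w)"
      using Mlj(2)[of p] by (auto simp: unit_mat_mult_right[OF j n_pos M] nc_mult_const_right)
  qed
  then have "h M \<otimes> h (E j 0) = (\<Oplus>l\<in>{..<n}. h (unit_mat (M l j) l 0))"
    using hom_mult[OF h M E_in[OF j n_pos]] hom_sum[OF h, of "{..<n}" "\<lambda>l. unit_mat (M l j) l 0"]
    by (simp add: unit_mat_in n_pos Mlj)
  also have "\<dots> = (\<Oplus>l\<in>{..<n}. h (E l 0) \<otimes> h (unit_mat (M l j) 0 0))"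
    by (rule finsum_cong')
      (auto simp: hom_unit_mult[OF h] n_pos Mlj nc_const_in_free_algebra nc_mult_const_left
        intro!: ring_hom_closed[OF h] unit_mat_in)
  finally show ?thesis .
qed

text \<open>View \<open>T\<close> as a bimodule over the matrix ring, with \<open>\<rho>\<^sub>1\<close> acting on the left and \<open>\<rho>\<^sub>2\<close>
  on the right. Then \<open>T\<close> is a matrix bimodule, and \<open>entry i j\<close> are the matrix
  entries of its element \<open>\<one>\<close>; a matrix on which both homomorphisms agree commutes with \<open>\<one>\<close>.\<close>

definition entry :: "nat \<Rightarrow> nat \<Rightarrow> 'a" where
  "entry i j = \<rho>\<^sub>1 (E 0 i) \<otimes> \<rho>\<^sub>2 (E j 0)"

text \<open>\<open>scal 1\<close> is the image of the idempotent \<open>E 0 0\<close> and in general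
  differs from \<one>. It acts as the identity on the entries only because they lie in the corner
  cut out by that idempotent.\<close>

definition scal :: "'k \<Rightarrow> 'a" where
  "scal c = \<rho>\<^sub>1 (unit_mat (nc_const c) 0 0)"

lemma entry_closed [simp]: "i < n \<Longrightarrow> j < n \<Longrightarrow> entry i j \<in> carrier T"
  by (simp add: entry_def n_pos)

lemma scal_closed [simp]: "scal c \<in> carrier T"
  by (simp add: scal_def unit_mat_in n_pos nc_const_in_free_algebra)

text \<open>Both sides evaluate the product of the images of \<open>E 0 i\<close>, \<open>M\<close>
  and \<open>E j 0\<close>: one reads \<open>M\<close> through \<open>\<rho>\<^sub>1\<close> and
  expands its row i, the other reads it through \<open>\<rho>\<^sub>2\<close> and expands its column
  j.\<close>

lemma entry_exchange:
  assumes M: "M \<in> carrier S" and agree: "\<rho>\<^sub>1 M = \<rho>\<^sub>2 M" and ij: "i < n" "j < n"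
  shows "(\<Oplus>l\<in>{..<n}. \<rho>\<^sub>1 (unit_mat (M i l) 0 0) \<otimes> entry l j)
    = (\<Oplus>l\<in>{..<n}. entry i l \<otimes> \<rho>\<^sub>2 (unit_mat (M l j) 0 0))"
proof -
  have MA: "M p q \<in> carrier A" for p q
    using M unfolding free_matrix_ring_carrier by auto
  note [simp] = unit_mat_in[OF MA n_pos n_pos] n_pos ij
  have "(\<Oplus>l\<in>{..<n}. \<rho>\<^sub>1 (unit_mat (M i l) 0 0) \<otimes> entry l j)
      = (\<Oplus>l\<in>{..<n}. (\<rho>\<^sub>1 (unit_mat (M i l) 0 0) \<otimes> \<rho>\<^sub>1 (E 0 l)) \<otimes> \<rho>\<^sub>2 (E j 0))"
    by (rule finsum_cong') (auto simp: entry_def m_assoc)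
  also have "\<dots> = (\<rho>\<^sub>1 (E 0 i) \<otimes> \<rho>\<^sub>1 M) \<otimes> \<rho>\<^sub>2 (E j 0)"
    unfolding hom_row[OF hom1 M ij(1)] by (subst finsum_ldistr) auto
  also have "\<dots> = \<rho>\<^sub>1 (E 0 i) \<otimes> (\<rho>\<^sub>2 M \<otimes> \<rho>\<^sub>2 (E j 0))"
    using M by (simp add: agree m_assoc)
  also have "\<dots> = (\<Oplus>l\<in>{..<n}. \<rho>\<^sub>1 (E 0 i) \<otimes> (\<rho>\<^sub>2 (E l 0) \<otimes> \<rho>\<^sub>2 (unit_mat (M l j) 0 0)))"
    unfolding hom_col[OF hom2 M ij(2)] by (subst finsum_rdistr) auto
  also have "\<dots> = (\<Oplus>l\<in>{..<n}. entry i l \<otimes> \<rho>\<^sub>2 (unit_mat (M l j) 0 0))"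
    by (rule finsum_cong') (auto simp: entry_def m_assoc)
  finally show ?thesis .
qed

lemma scalar_mat_in: "const_mat (scalar_mat n c) \<in> carrier S"
  by (rule const_mat_in_free_matrix_ring) (auto simp: scalar_mat_def split: if_splits)

lemma scalar_mult_E:
  assumes "i < n" "j < n"
  shows "nc_mat_mult n (const_mat (scalar_mat n c)) (E i j) = unit_mat (nc_const c) i j"
    "nc_mat_mult n (E i j) (const_mat (scalar_mat n c)) = unit_mat (nc_const c) i j"
  unfolding unit_mat_mult_right[OF assms scalar_mat_in] unit_mat_mult_left[OF assms scalar_mat_in]
  using assms
  by (auto simp: const_mat_def scalar_mat_def unit_mat_def nc_mult_const_const fun_eq_iff)

text \<open>On a matrix unit, a scalar in the corner acts like a scalar matrix. Scalar matrices have
  the same image under both homomorphisms and commute with matrix units, so the scalar travels from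
  the right end of the product to the left end.\<close>

lemma entry_scal:
  assumes ij: "i < n" "j < n"
  shows "entry i j \<otimes> \<rho>\<^sub>2 (unit_mat (nc_const c) 0 0) = scal c \<otimes> entry i j"
proof -
  note [simp] = n_pos ij unit_mat_in nc_const_in_free_algebra scalar_mat_in
  have "\<rho>\<^sub>2 (E j 0) \<otimes> \<rho>\<^sub>2 (unit_mat (nc_const c) 0 0) = \<rho>\<^sub>2 (unit_mat (nc_const c) j 0)"
    by (simp add: hom_unit_mult[OF hom2] nc_mult_const_const)
  also have "\<dots> = \<rho>\<^sub>2 (const_mat (scalar_mat n c)) \<otimes> \<rho>\<^sub>2 (E j 0)"
    by (simp add: hom_mult[OF hom2, symmetric] scalar_mult_E)
  finally have 2: "\<rho>\<^sub>2 (E j 0) \<otimes> \<rho>\<^sub>2 (unit_mat (nc_const c) 0 0)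
    = \<rho>\<^sub>1 (const_mat (scalar_mat n c)) \<otimes> \<rho>\<^sub>2 (E j 0)" by (simp add: scalars_agree)
  have "\<rho>\<^sub>1 (E 0 i) \<otimes> \<rho>\<^sub>1 (const_mat (scalar_mat n c)) = \<rho>\<^sub>1 (unit_mat (nc_const c) 0 i)"
    by (simp add: hom_mult[OF hom1, symmetric] scalar_mult_E)
  also have "\<dots> = scal c \<otimes> \<rho>\<^sub>1 (E 0 i)"
    by (simp add: scal_def hom_unit_mult[OF hom1] nc_mult_const_const)
  finally have 1: "\<rho>\<^sub>1 (E 0 i) \<otimes> \<rho>\<^sub>1 (const_mat (scalar_mat n c)) = scal c \<otimes> \<rho>\<^sub>1 (E 0 i)" .
  have "entry i j \<otimes> \<rho>\<^sub>2 (unit_mat (nc_const c) 0 0)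
      = \<rho>\<^sub>1 (E 0 i) \<otimes> (\<rho>\<^sub>2 (E j 0) \<otimes> \<rho>\<^sub>2 (unit_mat (nc_const c) 0 0))"
    by (simp add: entry_def m_assoc)
  also have "\<dots> = (\<rho>\<^sub>1 (E 0 i) \<otimes> \<rho>\<^sub>1 (const_mat (scalar_mat n c))) \<otimes> \<rho>\<^sub>2 (E j 0)"
    by (simp add: 2 m_assoc)
  also have "\<dots> = scal c \<otimes> entry i j"
    by (simp add: 1 entry_def m_assoc)
  finally show ?thesis .
qed

lemma scal_add: "scal (c + d) = scal c \<oplus> scal d"
proof -
  have u: "unit_mat (nc_const x) 0 0 \<in> carrier S" for x :: 'k
    by (simp add: unit_mat_in n_pos nc_const_in_free_algebra)
  have "unit_mat (nc_const (c + d) :: 'x list \<Rightarrow> 'k) 0 0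
      = (\<lambda>i j w. unit_mat (nc_const c) 0 0 i j w + unit_mat (nc_const d) 0 0 i j w)"
    by (auto simp: unit_mat_def nc_const_def fun_eq_iff)
  then show ?thesis
    using ring_hom_add[OF hom1 u u] by (simp add: scal_def free_matrix_ring_add[OF u u])
qed

lemma scal_mult: "scal (c * d) = scal c \<otimes> scal d"
  by (simp add: scal_def hom_unit_mult[OF hom1] n_pos nc_const_in_free_algebra nc_mult_const_const)

lemma scal_zero [simp]: "scal 0 = \<zero>"
proof -
  have "unit_mat (\<lambda>w :: 'x list. 0 :: 'k) 0 0 = (\<lambda>i j w. 0)" by (auto simp: unit_mat_def fun_eq_iff)
  then show ?thesis using hom_zero[OF hom1] by (simp add: scal_def)
qed

lemma scal_one_entry: "i < n \<Longrightarrow> j < n \<Longrightarrow> scal 1 \<otimes> entry i j = entry i j"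
  unfolding scal_def entry_def
  by (simp add: m_assoc[symmetric] hom_unit_mult[OF hom1] n_pos nc_const_in_free_algebra
      nc_mult_const_const)

section \<open>Linear relations between the entries of the unit\<close>

text \<open>Here \<open>g\<close> holds the coefficients of a linear form in n^2 unknowns and
  \<open>pairing g\<close> is its value at the matrix of entries. The \<open>g\<close> with value
  \<zero> are exactly the k-linear relations between the entries.\<close>

definition pairing :: "(nat \<times> nat \<Rightarrow> 'k) \<Rightarrow> 'a" where
  "pairing g = (\<Oplus>i\<in>{..<n}. \<Oplus>j\<in>{..<n}. scal (g (i, j)) \<otimes> entry i j)"

lemma pairing_closed [simp]: "pairing g \<in> carrier T"
  unfolding pairing_def by (auto intro!: finsum_closed)

lemma pairing_cong:
  assumes "\<And>p. p \<in> {..<n} \<times> {..<n} \<Longrightarrow> g p = h p"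
  shows "pairing g = pairing h"
  unfolding pairing_def using assms by (auto intro!: finsum_cong' finsum_closed)

lemma pairing_add: "pairing (\<lambda>p. g p + h p) = pairing g \<oplus> pairing h"
proof -
  have "pairing (\<lambda>p. g p + h p) = (\<Oplus>i\<in>{..<n}. (\<Oplus>j\<in>{..<n}. scal (g (i, j)) \<otimes> entry i j)
      \<oplus> (\<Oplus>j\<in>{..<n}. scal (h (i, j)) \<otimes> entry i j))"
    unfolding pairing_def
  proof (rule finsum_cong'[OF refl])
    fix i assume i: "i \<in> {..<n}"
    have "(\<Oplus>j\<in>{..<n}. scal (g (i, j) + h (i, j)) \<otimes> entry i j)
        = (\<Oplus>j\<in>{..<n}. scal (g (i, j)) \<otimes> entry i j \<oplus> scal (h (i, j)) \<otimes> entry i j)"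
      using i by (intro finsum_cong' refl) (auto simp: scal_add l_distr)
    also have "\<dots> = (\<Oplus>j\<in>{..<n}. scal (g (i, j)) \<otimes> entry i j)
        \<oplus> (\<Oplus>j\<in>{..<n}. scal (h (i, j)) \<otimes> entry i j)"
      using i by (intro finsum_addf) auto
    finally show "(\<Oplus>j\<in>{..<n}. scal (g (i, j) + h (i, j)) \<otimes> entry i j)
        = (\<Oplus>j\<in>{..<n}. scal (g (i, j)) \<otimes> entry i j)
          \<oplus> (\<Oplus>j\<in>{..<n}. scal (h (i, j)) \<otimes> entry i j)" .
  qed (auto intro!: a_closed finsum_closed)
  also have "\<dots> = pairing g \<oplus> pairing h"
    unfolding pairing_def by (intro finsum_addf) (auto intro!: finsum_closed)
  finally show ?thesis .
qed

lemma pairing_scale: "pairing (\<lambda>p. c * g p) = scal c \<otimes> pairing g"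
proof -
  have "scal c \<otimes> pairing g = (\<Oplus>i\<in>{..<n}. scal c \<otimes> (\<Oplus>j\<in>{..<n}. scal (g (i, j)) \<otimes> entry i j))"
    unfolding pairing_def by (intro finsum_rdistr) (auto intro!: finsum_closed)
  also have "\<dots> = pairing (\<lambda>p. c * g p)"
    unfolding pairing_def
  proof (rule finsum_cong'[OF refl])
    fix i assume i: "i \<in> {..<n}"
    have "scal c \<otimes> (\<Oplus>j\<in>{..<n}. scal (g (i, j)) \<otimes> entry i j)
        = (\<Oplus>j\<in>{..<n}. scal c \<otimes> (scal (g (i, j)) \<otimes> entry i j))"
      using i by (intro finsum_rdistr) auto
    also have "\<dots> = (\<Oplus>j\<in>{..<n}. scal (c * g (i, j)) \<otimes> entry i j)"
      using i by (intro finsum_cong' refl) (auto simp: scal_mult m_assoc)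
    finally show "scal c \<otimes> (\<Oplus>j\<in>{..<n}. scal (g (i, j)) \<otimes> entry i j)
        = (\<Oplus>j\<in>{..<n}. scal (c * g (i, j)) \<otimes> entry i j)" .
  qed (auto intro!: finsum_closed)
  finally show ?thesis by simp
qed

lemma pairing_zero: "pairing (\<lambda>p. 0) = \<zero>"
  using pairing_scale[of 0 "\<lambda>p. 0"] by simp

lemma pairing_diff:
  assumes "pairing g = pairing h"
  shows "pairing (\<lambda>p. g p - h p) = \<zero>"
proof -
  have "pairing (\<lambda>p. g p - h p) = pairing (\<lambda>p. h p + (- 1) * h p)"
    using pairing_add[of g "\<lambda>p. (- 1) * h p"] pairing_add[of h "\<lambda>p. (- 1) * h p"] assms by simp
  then show ?thesis by (simp add: pairing_zero)
qed

lemma pairing_column: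
  assumes "j < n"
  shows "pairing (\<lambda>(p, q). if q = j then c p else 0) = (\<Oplus>l\<in>{..<n}. scal (c l) \<otimes> entry l j)"
  unfolding pairing_def
proof (rule finsum_cong'[OF refl])
  fix l assume l: "l \<in> {..<n}"
  have "(\<Oplus>q\<in>{..<n}. scal (case (l, q) of (p, q) \<Rightarrow> if q = j then c p else 0) \<otimes> entry l q)
      = (\<Oplus>q\<in>{..<n}. if q = j then scal (c l) \<otimes> entry l q else \<zero>)"
    by (rule finsum_cong'[OF refl]) (use l in auto)
  also have "\<dots> = scal (c l) \<otimes> entry l j"
    using assms l by (intro add.finprod_singleton_swap) auto
  finally show "(\<Oplus>q\<in>{..<n}. scal (case (l, q) of (p, q) \<Rightarrow> if q = j then c p else 0) \<otimes> entry l q)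
      = scal (c l) \<otimes> entry l j" .
qed (use assms in auto)

lemma pairing_row:
  assumes "i < n"
  shows "pairing (\<lambda>(p, q). if p = i then c q else 0) = (\<Oplus>l\<in>{..<n}. scal (c l) \<otimes> entry i l)"
proof -
  have "pairing (\<lambda>(p, q). if p = i then c q else 0)
      = (\<Oplus>p\<in>{..<n}. if p = i then (\<Oplus>l\<in>{..<n}. scal (c l) \<otimes> entry p l) else \<zero>)"
    unfolding pairing_def
    by (rule finsum_cong') (auto intro!: finsum_closed add.finprod_one_eqI)
  also have "\<dots> = (\<Oplus>l\<in>{..<n}. scal (c l) \<otimes> entry i l)"
    using assms by (intro add.finprod_singleton_swap) (auto intro!: finsum_closed)
  finally show ?thesis .
qed

lemma pairing_delta:
  assumes "i < n" "j < n"
  shows "pairing (\<lambda>p. if p = (i, j) then 1 else 0) = entry i j"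
proof -
  have "pairing (\<lambda>p. if p = (i, j) then 1 else 0)
      = pairing (\<lambda>(p, q). if q = j then (if p = i then 1 else 0) else 0)"
    by (rule pairing_cong) (auto split: if_splits)
  also have "\<dots> = (\<Oplus>l\<in>{..<n}. if l = i then entry l j else \<zero>)"
    unfolding pairing_column[OF assms(2)]
    by (rule finsum_cong') (use assms in \<open>auto simp: scal_one_entry\<close>)
  also have "\<dots> = entry i j"
    using assms by (intro add.finprod_singleton_swap) auto
  finally show ?thesis .
qed

text \<open>With m the matrix of entries, position (i, j) of M m - m M is a linear form in m, and
  these are its coefficients. The hypothesis already has all scalars on the left, so it says that
  this form vanishes at m.\<close>

lemma pairing_commutator:
  assumes ij: "i < n" "j < n"
    and eq: "(\<Oplus>l\<in>{..<n}. scal (M i l) \<otimes> entry l j) = (\<Oplus>l\<in>{..<n}. scal (M l j) \<otimes> entry i l)"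
  shows "pairing (\<lambda>(p, q). (if q = j then M i p else 0) - (if p = i then M q j else 0)) = \<zero>"
proof -
  have "pairing (\<lambda>(p, q). if q = j then M i p else 0)
      = pairing (\<lambda>(p, q). if p = i then M q j else 0)"
    unfolding pairing_column[OF ij(2)] pairing_row[OF ij(1)] by (rule eq)
  from pairing_diff[OF this] show ?thesis by (simp add: case_prod_unfold)
qed

lemma const_exchange:
  assumes M: "const_mat M \<in> carrier S" and agree: "\<rho>\<^sub>1 (const_mat M) = \<rho>\<^sub>2 (const_mat M)"
    and ij: "i < n" "j < n"
  shows "(\<Oplus>l\<in>{..<n}. scal (M i l) \<otimes> entry l j) = (\<Oplus>l\<in>{..<n}. scal (M l j) \<otimes> entry i l)"
proof -
  have "(\<Oplus>l\<in>{..<n}. scal (M i l) \<otimes> entry l j)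
      = (\<Oplus>l\<in>{..<n}. entry i l \<otimes> \<rho>\<^sub>2 (unit_mat (nc_const (M l j)) 0 0))"
    using entry_exchange[OF M agree ij] by (simp add: scal_def const_mat_def)
  also have "\<dots> = (\<Oplus>l\<in>{..<n}. scal (M l j) \<otimes> entry i l)"
    by (rule finsum_cong') (use ij in \<open>auto simp: entry_scal\<close>)
  finally show ?thesis .
qed

text \<open>Multiply \<open>\<rho>\<^sub>1 (E a b)\<close> on the right by \<one>, written as the
  sum of all \<open>\<rho>\<^sub>2 (E j j)\<close>. Every summand passes through
  \<open>entry b j\<close>, so only j = b survives. Expanding \<open>\<rho>\<^sub>2 (E a b)\<close>
  on the left instead leaves \<open>entry a a\<close> between the same outer factors.\<close>

lemma unit_agree:
  assumes off: "\<And>i j. i < n \<Longrightarrow> j < n \<Longrightarrow> i \<noteq> j \<Longrightarrow> entry i j = \<zero>"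
    and diag: "\<And>i j. i < n \<Longrightarrow> j < n \<Longrightarrow> entry i i = entry j j"
    and ab: "a < n" "b < n"
  shows "\<rho>\<^sub>1 (E a b) = \<rho>\<^sub>2 (E a b)"
proof -
  note [simp] = n_pos ab
  have EE: "h (E i j) \<otimes> h (E j l) = h (E i l)" if "h \<in> ring_hom S T" "i < n" "j < n" "l < n" for h i j l
    using that by (simp add: hom_unit_mult nc_const_in_free_algebra nc_mult_const_const)
  have one: "(\<Oplus>i\<in>{..<n}. h (E i i)) = \<one>" if h: "h \<in> ring_hom S T" for h
  proof -
    have "(\<Oplus>i\<in>{..<n}. h (E i i)) = h (\<lambda>p q w. \<Sum>i\<in>{..<n}. E i i p q w)"
      by (rule hom_sum[OF h, symmetric]) auto
    also have "(\<lambda>p q w. \<Sum>i\<in>{..<n}. E i i p q w) = const_mat (scalar_mat n 1)"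
    proof (intro ext)
      fix p q and w :: "'x list"
      have "(\<Sum>i\<in>{..<n}. E i i p q w) = (\<Sum>i\<in>{..<n}. if i = p then (if p = q then nc_const 1 w else 0) else 0)"
        by (intro sum.cong) (auto simp: unit_mat_def)
      then show "(\<Sum>i\<in>{..<n}. E i i p q w) = const_mat (scalar_mat n 1) p q w"
        by (auto simp: const_mat_def scalar_mat_def)
    qed
    also have "h \<dots> = \<one>" using ring_hom_one[OF h] by (simp add: free_matrix_ring_one)
    finally show ?thesis .
  qed
  have 1: "\<rho>\<^sub>1 (E a b) = \<rho>\<^sub>1 (E a 0) \<otimes> entry b b \<otimes> \<rho>\<^sub>2 (E 0 b)"
  proof -
    have "\<rho>\<^sub>1 (E a b) = \<rho>\<^sub>1 (E a b) \<otimes> (\<Oplus>j\<in>{..<n}. \<rho>\<^sub>2 (E j j))" by (simp add: one[OF hom2])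
    also have "\<dots> = (\<Oplus>j\<in>{..<n}. \<rho>\<^sub>1 (E a b) \<otimes> \<rho>\<^sub>2 (E j j))" by (rule finsum_rdistr) auto
    also have "\<dots> = (\<Oplus>j\<in>{..<n}. if j = b then \<rho>\<^sub>1 (E a 0) \<otimes> entry b j \<otimes> \<rho>\<^sub>2 (E 0 j) else \<zero>)"
    proof (rule finsum_cong'[OF refl])
      fix j assume "j \<in> {..<n}"
      then have "\<rho>\<^sub>1 (E a 0) \<otimes> \<rho>\<^sub>1 (E 0 b) \<otimes> (\<rho>\<^sub>2 (E j 0) \<otimes> \<rho>\<^sub>2 (E 0 j))
          = \<rho>\<^sub>1 (E a 0) \<otimes> entry b j \<otimes> \<rho>\<^sub>2 (E 0 j)"
        by (simp add: entry_def m_assoc)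
      then have "\<rho>\<^sub>1 (E a b) \<otimes> \<rho>\<^sub>2 (E j j) = \<rho>\<^sub>1 (E a 0) \<otimes> entry b j \<otimes> \<rho>\<^sub>2 (E 0 j)"
        using \<open>j \<in> {..<n}\<close> by (simp add: EE[OF hom1] EE[OF hom2])
      then show "\<rho>\<^sub>1 (E a b) \<otimes> \<rho>\<^sub>2 (E j j)
          = (if j = b then \<rho>\<^sub>1 (E a 0) \<otimes> entry b j \<otimes> \<rho>\<^sub>2 (E 0 j) else \<zero>)"
        using \<open>j \<in> {..<n}\<close> off[of b j] by auto
    qed auto
    also have "\<dots> = \<rho>\<^sub>1 (E a 0) \<otimes> entry b b \<otimes> \<rho>\<^sub>2 (E 0 b)"
      by (intro add.finprod_singleton_swap) auto
    finally show ?thesis .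
  qed
  have 2: "\<rho>\<^sub>2 (E a b) = \<rho>\<^sub>1 (E a 0) \<otimes> entry a a \<otimes> \<rho>\<^sub>2 (E 0 b)"
  proof -
    have "\<rho>\<^sub>2 (E a b) = (\<Oplus>i\<in>{..<n}. \<rho>\<^sub>1 (E i i)) \<otimes> \<rho>\<^sub>2 (E a b)" by (simp add: one[OF hom1])
    also have "\<dots> = (\<Oplus>i\<in>{..<n}. \<rho>\<^sub>1 (E i i) \<otimes> \<rho>\<^sub>2 (E a b))" by (rule finsum_ldistr) auto
    also have "\<dots> = (\<Oplus>i\<in>{..<n}. if i = a then \<rho>\<^sub>1 (E i 0) \<otimes> entry i a \<otimes> \<rho>\<^sub>2 (E 0 b) else \<zero>)"
    proof (rule finsum_cong'[OF refl])
      fix i assume "i \<in> {..<n}"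
      then have "\<rho>\<^sub>1 (E i 0) \<otimes> \<rho>\<^sub>1 (E 0 i) \<otimes> (\<rho>\<^sub>2 (E a 0) \<otimes> \<rho>\<^sub>2 (E 0 b))
          = \<rho>\<^sub>1 (E i 0) \<otimes> entry i a \<otimes> \<rho>\<^sub>2 (E 0 b)"
        by (simp add: entry_def m_assoc)
      then have "\<rho>\<^sub>1 (E i i) \<otimes> \<rho>\<^sub>2 (E a b) = \<rho>\<^sub>1 (E i 0) \<otimes> entry i a \<otimes> \<rho>\<^sub>2 (E 0 b)"
        using \<open>i \<in> {..<n}\<close> by (simp add: EE[OF hom1] EE[OF hom2])
      then show "\<rho>\<^sub>1 (E i i) \<otimes> \<rho>\<^sub>2 (E a b)
          = (if i = a then \<rho>\<^sub>1 (E i 0) \<otimes> entry i a \<otimes> \<rho>\<^sub>2 (E 0 b) else \<zero>)"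
        using \<open>i \<in> {..<n}\<close> off[of i a] by auto
    qed auto
    also have "\<dots> = \<rho>\<^sub>1 (E a 0) \<otimes> entry a a \<otimes> \<rho>\<^sub>2 (E 0 b)"
      by (intro add.finprod_singleton_swap) auto
    finally show ?thesis .
  qed
  show ?thesis using 1 2 diag[OF ab] by simp
qed

text \<open>Matrix units, scalar matrices and, for each indeterminate, one matrix having it as an
  entry generate the whole matrix ring: an entry in position (i, j) is carried to any place by
  multiplying with matrix units on both sides, and words arise by multiplication along the
  diagonal.\<close>

lemma homs_agree:
  assumes units: "\<And>a b. a < n \<Longrightarrow> b < n \<Longrightarrow> \<rho>\<^sub>1 (E a b) = \<rho>\<^sub>2 (E a b)"
    and vars: "\<And>x. x \<in> X \<Longrightarrow> \<exists>M\<in>carrier S. \<exists>i<n. \<exists>j<n. \<rho>\<^sub>1 M = \<rho>\<^sub>2 M \<and> M i j = nc_var x"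
    and M: "M \<in> carrier S"
  shows "\<rho>\<^sub>1 M = \<rho>\<^sub>2 M"
proof -
  let ?mono = "\<lambda>c u. (\<lambda>w. if w = u then c else 0) :: 'x list \<Rightarrow> 'k"
  have mono_in: "?mono c u \<in> carrier A" if "set u \<subseteq> X" for c u
    using that by (auto simp: free_algebra_sel split: if_splits)
  have var: "\<rho>\<^sub>1 (unit_mat (nc_var x) a b) = \<rho>\<^sub>2 (unit_mat (nc_var x) a b)"
    if x: "x \<in> X" and ab: "a < n" "b < n" for x a b
  proof -
    obtain N i j where N: "N \<in> carrier S" "i < n" "j < n" "\<rho>\<^sub>1 N = \<rho>\<^sub>2 N" "N i j = nc_var x"
      using vars[OF x] by blast
    let ?P = "nc_mat_mult n (E a i) N"
    have P: "?P \<in> carrier S" using N ab by (intro nc_mat_mult_closed) auto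
    have eq: "nc_mat_mult n ?P (E j b) = unit_mat (nc_var x) a b"
      unfolding unit_mat_mult_right[OF N(3) ab(2) P]
      unfolding unit_mat_mult_left[OF ab(1) N(2) N(1)]
      by (auto simp: unit_mat_def N(5) nc_mult_const_left nc_mult_const_right fun_eq_iff)
    have "h (nc_mat_mult n ?P (E j b)) = h (E a i) \<otimes> h N \<otimes> h (E j b)" if "h \<in> ring_hom S T" for h
      using N ab P by (simp add: hom_mult[OF that])
    from this[OF hom1] this[OF hom2] show ?thesis
      using N ab units by (simp add: eq)
  qed
  have word: "\<rho>\<^sub>1 (unit_mat (?mono 1 u) a b) = \<rho>\<^sub>2 (unit_mat (?mono 1 u) a b)"
    if "set u \<subseteq> X" "a < n" "b < n" for u a b
    using that
  proof (induction u)
    case Nil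
    have "?mono 1 [] = nc_const 1" by (auto simp: nc_const_def)
    then show ?case using units Nil by simp
  next
    case (Cons x u)
    have eq: "?mono 1 (x # u) = nc_mult (nc_var x) (?mono 1 u)"
      by (simp add: nc_var_def nc_mult_monomial fun_eq_iff)
    have "h (unit_mat (?mono 1 (x # u)) a b) = h (unit_mat (nc_var x) a a) \<otimes> h (unit_mat (?mono 1 u) a b)"
      if "h \<in> ring_hom S T" for h
      unfolding eq using Cons.prems
      by (intro hom_unit_mult[OF that, symmetric] nc_var_in_free_algebra mono_in) auto
    from this[OF hom1] this[OF hom2] show ?case using Cons var by simp
  qed
  have const: "\<rho>\<^sub>1 (unit_mat (nc_const c) a b) = \<rho>\<^sub>2 (unit_mat (nc_const c) a b)"
    if ab: "a < n" "b < n" for a b c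
    using hom_mult[OF hom1 scalar_mat_in E_in[OF ab], of c] units[OF ab] scalars_agree[of c]
      hom_mult[OF hom2 scalar_mat_in E_in[OF ab], of c]
    by (simp add: scalar_mult_E(1)[OF ab])
  have monomial: "\<rho>\<^sub>1 (unit_mat (?mono c u) a b) = \<rho>\<^sub>2 (unit_mat (?mono c u) a b)"
    if u: "set u \<subseteq> X" and ab: "a < n" "b < n" for u a b c
  proof -
    have eq: "?mono c u = nc_mult (nc_const c) (?mono 1 u)"
      by (auto simp: nc_mult_const_left)
    have "h (unit_mat (?mono c u) a b) = h (unit_mat (nc_const c) a a) \<otimes> h (unit_mat (?mono 1 u) a b)"
      if "h \<in> ring_hom S T" for h
      unfolding eq using u ab
      by (intro hom_unit_mult[OF that, symmetric] nc_const_in_free_algebra mono_in) auto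
    from this[OF hom1] this[OF hom2] show ?thesis
      using word[OF u ab] const[OF ab(1) ab(1), of c] by simp
  qed
  let ?U = "\<lambda>i j. {w. M i j w \<noteq> 0}"
  \<comment> \<open>One index for each position together with a word occurring in the entry there,
    so that \<open>M\<close> is a finite sum of monomials times matrix units.\<close>
  let ?I = "SIGMA p:{..<n} \<times> {..<n}. ?U (fst p) (snd p)"
  let ?f = "\<lambda>(p, u). unit_mat (?mono (M (fst p) (snd p) u) u) (fst p) (snd p)"
  have MA: "M i j \<in> carrier A" for i j using M unfolding free_matrix_ring_carrier by auto
  have fU: "finite (?U i j)" "w \<in> ?U i j \<Longrightarrow> set w \<subseteq> X" for i j w
    using MA[of i j] by (auto simp: free_algebra_sel)
  have fI: "finite ?I" using fU by auto
  have fin: "?f p \<in> carrier S" if "p \<in> ?I" for p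
    using that fU(2) by (auto intro!: unit_mat_in mono_in)
  have decomp: "M = (\<lambda>i j w. \<Sum>p\<in>?I. ?f p i j w)"
  proof (intro ext)
    fix i j w
    have "(\<Sum>p\<in>?I. ?f p i j w) = (\<Sum>p\<in>?I. if p = ((i, j), w) then M i j w else 0)"
      by (intro sum.cong) (auto simp: unit_mat_def split: if_splits)
    also have "\<dots> = M i j w"
      using fI M unfolding free_matrix_ring_carrier by (auto simp: sum.delta)
    finally show "M i j w = (\<Sum>p\<in>?I. ?f p i j w)" by simp
  qed
  have "\<rho>\<^sub>1 M = (\<Oplus>p\<in>?I. \<rho>\<^sub>1 (?f p))"
    by (rule trans[OF arg_cong[OF decomp, of \<rho>\<^sub>1] hom_sum[OF hom1 fI fin]])
  also have "\<dots> = (\<Oplus>p\<in>?I. \<rho>\<^sub>2 (?f p))"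
  proof (rule finsum_cong'[OF refl])
    show "(\<lambda>p. \<rho>\<^sub>2 (?f p)) \<in> ?I \<rightarrow> carrier T" using fin by (intro funcsetI hom_closed)
    show "\<rho>\<^sub>1 (?f p) = \<rho>\<^sub>2 (?f p)" if "p \<in> ?I" for p
      using that fU(2) by (auto intro!: monomial)
  qed
  also have "\<dots> = \<rho>\<^sub>2 M"
    by (rule trans[OF arg_cong[OF decomp, of \<rho>\<^sub>2] hom_sum[OF hom2 fI fin], symmetric])
  finally show ?thesis .
qed

end

section \<open>Relations between matrix entries by duality\<close>

text \<open>A subspace of a finite-dimensional space equals its double annihilator, proved by
  eliminating one coordinate at a time. The fifth assumption makes membership depend on the
  coordinates in \<open>I\<close> only, so total functions can represent vectors indexed by
  \<open>I\<close>.\<close>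

lemma double_annihilator:
  fixes W :: "('i \<Rightarrow> 'k::field) set"
  assumes "finite I"
    and "\<And>g h. g \<in> W \<Longrightarrow> h \<in> W \<Longrightarrow> (\<lambda>i. g i + h i) \<in> W"
    and "\<And>c g. g \<in> W \<Longrightarrow> (\<lambda>i. c * g i) \<in> W"
    and "(\<lambda>i. 0) \<in> W"
    and "\<And>g h. g \<in> W \<Longrightarrow> (\<And>i. i \<in> I \<Longrightarrow> g i = h i) \<Longrightarrow> h \<in> W"
    and "\<And>\<Theta>. (\<And>h. h \<in> W \<Longrightarrow> (\<Sum>i\<in>I. h i * \<Theta> i) = 0) \<Longrightarrow> (\<Sum>i\<in>I. g i * \<Theta> i) = 0"
  shows "g \<in> W"
  using assms
proof (induction I arbitrary: W g rule: finite_induct)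
  case empty
  show ?case by (rule empty.prems(4)[OF empty.prems(3)]) simp
next
  case (insert a I)
  note add = insert.prems(1) and scale = insert.prems(2) and zero = insert.prems(3)
    and cong = insert.prems(4) and ann = insert.prems(5)
  have sub: "(\<lambda>i. g i - c * h i) \<in> W" if "g \<in> W" "h \<in> W" for g h c
    using add[OF that(1) scale[OF that(2), of "- c"]] by simp
  \<comment> \<open>Overwriting the value at \<open>a\<close>, rather than requiring it to be zero,
    keeps membership independent of coordinates outside \<open>I\<close>, as the induction
    hypothesis demands.\<close>
  define W' where "W' = {h. h(a := 0) \<in> W}"
  have W'_iff: "h \<in> W' \<longleftrightarrow> h \<in> W" if "h a = 0" for h
    unfolding W'_def using fun_upd_triv[of h a] that by simp
  have IH: "g' \<in> W'"
    if "\<And>\<Theta>. (\<And>h. h \<in> W' \<Longrightarrow> (\<Sum>i\<in>I. h i * \<Theta> i) = 0) \<Longrightarrow> (\<Sum>i\<in>I. g' i * \<Theta> i) = 0" for g'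
  proof (rule insert.IH)
    show "(\<lambda>i. g i + h i) \<in> W'" if "g \<in> W'" "h \<in> W'" for g h
    proof -
      have eq: "(\<lambda>i. (g(a := 0)) i + (h(a := 0)) i) = (\<lambda>i. g i + h i)(a := 0)" by auto
      have "g(a := 0) \<in> W" "h(a := 0) \<in> W" using that unfolding W'_def by blast+
      from add[OF this] show ?thesis unfolding W'_def eq by blast
    qed
    show "(\<lambda>i. c * g i) \<in> W'" if "g \<in> W'" for c g
    proof -
      have eq: "(\<lambda>i. c * (g(a := 0)) i) = (\<lambda>i. c * g i)(a := 0)" by auto
      have "g(a := 0) \<in> W" using that unfolding W'_def by blast
      from scale[OF this, of c] show ?thesis unfolding W'_def eq by blast
    qed
    show "(\<lambda>i. 0) \<in> W'" using zero by (simp add: W'_iff)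
    show "h \<in> W'" if "g \<in> W'" "\<And>i. i \<in> I \<Longrightarrow> g i = h i" for g h
      using that by (auto simp: W'_def elim!: cong)
  qed (use that in blast)
  show ?case
  proof (cases "\<exists>h0\<in>W. h0 a \<noteq> 0")
    case True
    then obtain h0 where h0: "h0 \<in> W" "h0 a \<noteq> 0" by blast
    define red where "red h = (\<lambda>i. h i - h a / h0 a * h0 i)" for h
    have red_a: "red h a = 0" for h using h0 by (simp add: red_def)
    have "red g \<in> W'"
    proof (rule IH)
      fix \<Theta> assume \<Theta>: "\<And>h. h \<in> W' \<Longrightarrow> (\<Sum>i\<in>I. h i * \<Theta> i) = 0"
      \<comment> \<open>The value at \<open>a\<close> is chosen so that the extended functional
        annihilates \<open>h0\<close>. Since it already annihilates the part of \<open>W\<close>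
        vanishing at \<open>a\<close>, and \<open>red\<close> moves \<open>W\<close> into that part
        by subtracting multiples of \<open>h0\<close>, it annihilates all of
        \<open>W\<close>.\<close>
      define \<Theta>' where "\<Theta>' = \<Theta>(a := - (\<Sum>i\<in>I. h0 i * \<Theta> i) / h0 a)"
      have I_eq: "(\<Sum>i\<in>I. h i * \<Theta>' i) = (\<Sum>i\<in>I. h i * \<Theta> i)" for h
        using insert.hyps by (intro sum.cong) (auto simp: \<Theta>'_def)
      have h0_0: "(\<Sum>i\<in>insert a I. h0 i * \<Theta>' i) = 0"
        using insert.hyps h0 by (simp add: I_eq) (simp add: \<Theta>'_def)
      have red_sum: "(\<Sum>i\<in>insert a I. h i * \<Theta>' i) = (\<Sum>i\<in>I. red h i * \<Theta> i)" for h
      proof -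
        have "(\<Sum>i\<in>insert a I. red h i * \<Theta>' i)
            = (\<Sum>i\<in>insert a I. h i * \<Theta>' i) - h a / h0 a * (\<Sum>i\<in>insert a I. h0 i * \<Theta>' i)"
          unfolding red_def sum_distrib_left sum_subtractf[symmetric]
          by (intro sum.cong) (auto simp: algebra_simps)
        moreover have "(\<Sum>i\<in>insert a I. red h i * \<Theta>' i) = (\<Sum>i\<in>I. red h i * \<Theta> i)"
          using insert.hyps by (simp add: red_a I_eq)
        ultimately show ?thesis by (simp add: h0_0)
      qed
      have "(\<Sum>i\<in>insert a I. g i * \<Theta>' i) = 0"
      proof (rule ann)
        fix h assume "h \<in> W"
        then have "red h \<in> W" using sub h0(1) unfolding red_def by blast
        then have "red h \<in> W'" by (simp add: W'_iff red_a)
        then show "(\<Sum>i\<in>insert a I. h i * \<Theta>' i) = 0" by (simp only: red_sum \<Theta>)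
      qed
      then show "(\<Sum>i\<in>I. red g i * \<Theta> i) = 0" by (simp only: red_sum)
    qed
    then have "red g \<in> W" by (simp add: W'_iff red_a)
    from sub[OF this h0(1), of "- g a / h0 a"] show ?thesis by (simp add: red_def)
  next
    case False
    \<comment> \<open>Now every vector of \<open>W\<close> vanishes at \<open>a\<close>, so the
      coordinate functional at \<open>a\<close> annihilates \<open>W\<close>, and therefore
      \<open>g\<close>.\<close>
    have "(\<Sum>i\<in>insert a I. g i * (if i = a then 1 else 0)) = 0"
    proof (rule ann)
      fix h assume "h \<in> W"
      then have "h a = 0" using False by blast
      then show "(\<Sum>i\<in>insert a I. h i * (if i = a then 1 else 0)) = 0" by (intro sum.neutral) auto
    qed
    moreover have "(\<Sum>i\<in>I. g i * (if i = a then 1 else 0)) = 0"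
      using insert.hyps by (intro sum.neutral) auto
    ultimately have ga: "g a = 0" using insert.hyps by simp
    have "g \<in> W'"
    proof (rule IH)
      fix \<Theta> assume \<Theta>: "\<And>h. h \<in> W' \<Longrightarrow> (\<Sum>i\<in>I. h i * \<Theta> i) = 0"
      have "(\<Sum>i\<in>insert a I. g i * \<Theta> i) = 0"
      proof (rule ann)
        fix h assume h: "h \<in> W"
        then have "h a = 0" using False by blast
        with h show "(\<Sum>i\<in>insert a I. h i * \<Theta> i) = 0"
          using insert.hyps \<Theta>[of h] W'_iff by simp
      qed
      then show "(\<Sum>i\<in>I. g i * \<Theta> i) = 0" using insert.hyps ga by simp
    qed
    then show ?thesis by (simp add: W'_iff ga)
  qed
qed

section \<open>Duality applied to the matrix of entries\<close>

context hom_pair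
begin

text \<open>These are the specialisations of the matrix of entries: the matrices over k obtained by
  applying one k-linear functional to the span of the entries.\<close>

definition ann :: "(nat \<Rightarrow> nat \<Rightarrow> 'k) set" where
  "ann = {\<Theta>. (\<forall>i j. \<Theta> i j \<noteq> 0 \<longrightarrow> i < n \<and> j < n) \<and>
     (\<forall>h. pairing h = \<zero> \<longrightarrow> (\<Sum>(i, j)\<in>{..<n} \<times> {..<n}. h (i, j) * \<Theta> i j) = 0)}"

text \<open>The relations between the entries form a subspace whose annihilator is
  \<open>ann\<close>, so this is the double annihilator property. It turns claims about T into
  claims about matrices over k.\<close>

lemma pairing_zeroI:
  assumes "\<And>\<Theta>. \<Theta> \<in> ann \<Longrightarrow> (\<Sum>(i, j)\<in>{..<n} \<times> {..<n}. g (i, j) * \<Theta> i j) = 0"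
  shows "pairing g = \<zero>"
proof -
  let ?I = "{..<n} \<times> {..<n}"
  have "g \<in> {g. pairing g = \<zero>}"
  proof (rule double_annihilator[where I = ?I])
    fix \<Theta> assume \<Theta>: "\<And>h. h \<in> {g. pairing g = \<zero>} \<Longrightarrow> (\<Sum>p\<in>?I. h p * \<Theta> p) = 0"
    define \<Theta>' where "\<Theta>' = (\<lambda>i j. if i < n \<and> j < n then \<Theta> (i, j) else 0)"
    have eq: "(\<Sum>(i, j)\<in>?I. h (i, j) * \<Theta>' i j) = (\<Sum>p\<in>?I. h p * \<Theta> p)" for h
      by (intro sum.cong) (auto simp: \<Theta>'_def)
    have "\<Theta>' \<in> ann" using \<Theta> by (simp add: ann_def eq) (simp add: \<Theta>'_def)
    from assms[OF this] show "(\<Sum>p\<in>?I. g p * \<Theta> p) = 0" by (simp only: eq)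
  next
    show "h \<in> {g. pairing g = \<zero>}"
      if "g \<in> {g. pairing g = \<zero>}" "\<And>i. i \<in> ?I \<Longrightarrow> g i = h i" for g h
      using that pairing_cong[of g h] by simp
  qed (auto simp: pairing_add pairing_scale pairing_zero)
  then show ?thesis by simp
qed

lemma sum_delta_pair:
  assumes "i < n" "j < n"
  shows "(\<Sum>(p, q)\<in>{..<n} \<times> {..<n}. (if (p, q) = (i, j) then 1 else 0) * \<Theta> p q) = (\<Theta> i j :: 'k)"
proof -
  have "(\<Sum>(p, q)\<in>{..<n} \<times> {..<n}. (if (p, q) = (i, j) then 1 else 0) * \<Theta> p q)
      = (\<Sum>p\<in>{..<n} \<times> {..<n}. if p = (i, j) then \<Theta> i j else 0)"
    by (intro sum.cong) (auto split: if_splits)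
  then show ?thesis using assms by simp
qed

lemma entry_zeroI:
  assumes ij: "i < n" "j < n" and z: "\<And>\<Theta>. \<Theta> \<in> ann \<Longrightarrow> \<Theta> i j = 0"
  shows "entry i j = \<zero>"
  unfolding pairing_delta[OF ij, symmetric]
proof (rule pairing_zeroI)
  fix \<Theta> assume "\<Theta> \<in> ann"
  from z[OF this] show "(\<Sum>(p, q)\<in>{..<n} \<times> {..<n}. (if (p, q) = (i, j) then 1 else 0) * \<Theta> p q) = 0"
    by (simp only: sum_delta_pair[OF ij])
qed

lemma entry_eqI:
  assumes ij: "i < n" "j < n" and z: "\<And>\<Theta>. \<Theta> \<in> ann \<Longrightarrow> \<Theta> i i = \<Theta> j j"
  shows "entry i i = entry j j"
proof -
  let ?d = "\<lambda>i p. if p = (i, i) then 1 else 0 :: 'k"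
  have "pairing (\<lambda>p. ?d i p - ?d j p) = \<zero>"
  proof (rule pairing_zeroI)
    fix \<Theta> assume "\<Theta> \<in> ann"
    have "(\<Sum>(p, q)\<in>{..<n} \<times> {..<n}. (?d i (p, q) - ?d j (p, q)) * \<Theta> p q) = \<Theta> i i - \<Theta> j j"
      unfolding sum_delta_pair[OF ij(1) ij(1), of \<Theta>, symmetric]
        sum_delta_pair[OF ij(2) ij(2), of \<Theta>, symmetric] sum_subtractf[symmetric]
      by (intro sum.cong) (auto simp: left_diff_distrib)
    with z[OF \<open>\<Theta> \<in> ann\<close>]
    show "(\<Sum>(p, q)\<in>{..<n} \<times> {..<n}. (?d i (p, q) - ?d j (p, q)) * \<Theta> p q) = 0" by simp
  qed
  moreover have "pairing (\<lambda>p. (?d i p - ?d j p) + ?d j p) = pairing (\<lambda>p. ?d i p - ?d j p) \<oplus> pairing (?d j)"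
    by (rule pairing_add)
  ultimately have "pairing (?d i) = \<zero> \<oplus> pairing (?d j)" by simp
  then show ?thesis using pairing_delta ij by simp
qed

text \<open>Commutation is stated for a single position because, for the arrow e', the relation
  between the entries is free of indeterminates in one block only.\<close>

lemma ann_commutes_at:
  assumes \<Theta>: "\<Theta> \<in> ann" and ij: "i < n" "j < n"
    and eq: "(\<Oplus>l\<in>{..<n}. scal (M i l) \<otimes> entry l j) = (\<Oplus>l\<in>{..<n}. scal (M l j) \<otimes> entry i l)"
  shows "mat_mult n M \<Theta> i j = mat_mult n \<Theta> M i j"
proof -
  let ?I = "{..<n} \<times> {..<n}"
  have "(\<Sum>(p, q)\<in>?I. ((if q = j then M i p else 0) - (if p = i then M q j else 0)) * \<Theta> p q) = 0"
    using \<Theta> pairing_commutator[OF ij eq] unfolding ann_def by fastforce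
  moreover have "(\<Sum>(p, q)\<in>?I. ((if q = j then M i p else 0) - (if p = i then M q j else 0)) * \<Theta> p q)
      = (\<Sum>(p, q)\<in>?I. if q = j then M i p * \<Theta> p q else 0) - (\<Sum>(p, q)\<in>?I. if p = i then \<Theta> p q * M q j else 0)"
    unfolding sum_subtractf[symmetric] by (intro sum.cong) (auto simp: algebra_simps)
  moreover have "(\<Sum>(p, q)\<in>?I. if q = j then M i p * \<Theta> p q else 0) = (\<Sum>p<n. M i p * \<Theta> p j)"
    using ij by (simp add: sum.cartesian_product[symmetric])
  moreover have "(\<Sum>(p, q)\<in>?I. if p = i then \<Theta> p q * M q j else 0) = (\<Sum>q<n. \<Theta> i q * M q j)"
  proof -
    have "(\<Sum>(p, q)\<in>?I. if p = i then \<Theta> p q * M q j else 0)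
        = (\<Sum>p<n. if p = i then \<Sum>q<n. \<Theta> p q * M q j else 0)"
      unfolding sum.cartesian_product[symmetric] by (intro sum.cong) auto
    then show ?thesis using ij by simp
  qed
  ultimately show ?thesis using ij by (simp add: mat_mult_def)
qed

lemma ann_commutes:
  assumes \<Theta>: "\<Theta> \<in> ann" and M: "const_mat M \<in> carrier S"
    and agree: "\<rho>\<^sub>1 (const_mat M) = \<rho>\<^sub>2 (const_mat M)"
  shows "mat_mult n \<Theta> M = mat_mult n M \<Theta>"
proof (intro ext)
  fix i j
  show "mat_mult n \<Theta> M i j = mat_mult n M \<Theta> i j"
  proof (cases "i < n \<and> j < n")
    case True
    then show ?thesis using ann_commutes_at[OF \<Theta> _ _ const_exchange[OF M agree]] by simp
  qed (auto simp: mat_mult_def)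
qed

text \<open>Commuting with the idempotent of a vertex forces the vanishing of all entries between
  that vertex and the others.\<close>

lemma ann_block_diagonal:
  assumes \<Theta>: "\<Theta> \<in> ann"
    and agree: "\<And>v. v \<in> Q0 \<Longrightarrow>
      \<rho>\<^sub>1 (const_mat (vertex_idem n blk v)) = \<rho>\<^sub>2 (const_mat (vertex_idem n blk v))"
    and blk: "\<And>i. i < n \<Longrightarrow> blk i \<in> Q0" and nz: "\<Theta> i j \<noteq> 0"
  shows "i < n \<and> j < n \<and> blk i = blk j"
proof -
  have ij: "i < n" "j < n" using \<Theta> nz by (auto simp: ann_def)
  let ?V = "vertex_idem n blk (blk i) :: nat \<Rightarrow> nat \<Rightarrow> 'k"
  have "const_mat ?V \<in> carrier S"
    by (rule const_mat_in_free_matrix_ring) (auto simp: vertex_idem_def split: if_splits)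
  then have "mat_mult n \<Theta> ?V i j = mat_mult n ?V \<Theta> i j"
    using ann_commutes[OF \<Theta> _ agree[OF blk[OF ij(1)]]] by simp
  moreover have "(\<Sum>l<n. \<Theta> i l * ?V l j)
      = (\<Sum>l<n. if l = j then (if blk j = blk i then \<Theta> i j else 0) else 0)"
    using ij by (intro sum.cong) (auto simp: vertex_idem_def)
  moreover have "(\<Sum>l<n. ?V i l * \<Theta> l j) = (\<Sum>l<n. if l = i then \<Theta> i j else 0)"
    using ij by (intro sum.cong) (auto simp: vertex_idem_def)
  ultimately show ?thesis using ij nz by (simp add: mat_mult_def split: if_splits)
qed

end

section \<open>The epimorphism\<close>

lemma mat_vec_delta:
  "j < n \<Longrightarrow> mat_vec n A (\<lambda>i. if i = j then 1 else 0) = (\<lambda>i. if i < n then A i j else 0)"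
  by (auto simp: mat_vec_def fun_eq_iff if_distrib cong: if_cong)

text \<open>Apply \<open>\<Theta>\<close> to the basis vector with index j: the result is column j
  of \<open>\<Theta>\<close>. This converts each invariance hypothesis into a pattern of
  zeros.\<close>

lemma coord_span_invariant_entry:
  assumes inv: "\<forall>x\<in>coord_span I. mat_vec n \<Theta> x \<in> coord_span J"
    and "j \<in> I" "j < n" "l < n" "\<Theta> l j \<noteq> 0"
  shows "l \<in> J"
proof -
  have "(\<lambda>i. if i = j then 1 else 0) \<in> coord_span I" using assms(2) by (auto simp: coord_span_def)
  with inv have "mat_vec n \<Theta> (\<lambda>i. if i = j then 1 else 0) \<in> coord_span J" by blast
  then have "(\<lambda>i. if i < n then \<Theta> i j else 0) \<in> coord_span J" by (simp only: mat_vec_delta[OF \<open>j < n\<close>])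
  then show ?thesis using assms(4,5) by (auto simp: coord_span_def)
qed

theorem mainTheorem13:
  fixes Q0 :: "'v set" and Q1' :: "'a set" and src tgt :: "'a \<Rightarrow> 'v" and e :: 'a
    and n :: nat and blk :: "nat \<Rightarrow> 'v" and F :: "'a \<Rightarrow> nat \<Rightarrow> nat \<Rightarrow> 'k::field"
    and ds dt ks r :: nat
  assumes k_closed: "alg_closed TYPE('k)"
    and Q'_fin: "finite_quiver Q0 Q1' src tgt"
    and Q'_acyc: "acyclic_quiver Q0 Q1' src tgt"
    and e_arrow: "e \<in> Q1'"
    and rep: "is_rep Q0 Q1' src tgt n blk F"
    and brick: "is_brick Q1' n blk F"
    and layout: "ds + dt \<le> n"
      "\<forall>i<n. (blk i = src e \<longleftrightarrow> i < ds) \<and> (blk i = tgt e \<longleftrightarrow> ds \<le> i \<and> i < ds + dt)"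
    and sizes: "ks \<le> ds" "r \<le> dt"
    and ker_basis: "ker_arrow n (F e) ds = coord_span {..<ks}"
    and im_basis: "im_arrow n (F e) ds = coord_span {ds..<ds + r}"
    and not_full_rank: "r < min ds dt"
    and ker_inv: "\<forall>\<Theta>\<in>rep_End (Q1' - {e}) n blk F.
                    \<forall>x\<in>ker_arrow n (F e) ds. mat_vec n \<Theta> x \<in> ker_arrow n (F e) ds"
    and im_inv: "\<forall>\<Theta>\<in>rep_End (Q1' - {e}) n blk F.
                    \<forall>x\<in>im_arrow n (F e) ds. mat_vec n \<Theta> x \<in> im_arrow n (F e) ds"
  shows "\<forall>b11 b22.
     (b11 \<longrightarrow> (\<forall>\<Theta>\<in>rep_End (Q1' - {e}) n blk F.
                 \<forall>x\<in>coord_span {ks..<ds}. mat_vec n \<Theta> x \<in> coord_span {ks..<ds})) \<longrightarrow>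
     (b22 \<longrightarrow> (\<forall>\<Theta>\<in>rep_End (Q1' - {e}) n blk F.
                 \<forall>x\<in>coord_span {ds + r..<ds + dt}. mat_vec n \<Theta> x \<in> coord_span {ds + r..<ds + dt})) \<longrightarrow>
     (\<exists>f. ring_epimorphism TYPE('c)
            (path_algebra Q0 Q1' src tgt :: (('v \<times> 'a list) \<Rightarrow> 'k) ring)
            (matrix_ring n (free_algebra (var_set b11 b22 ks ds dt r))) f
          \<and> (\<forall>x\<in>carrier (path_algebra Q0 (Q1' - {e}) src tgt :: (('v \<times> 'a list) \<Rightarrow> 'k) ring).
                f x = const_mat (action_hom n blk F x))
          \<and> f (path_elem (src e, [e])) = fe_matrix b11 b22 ks ds dt r (F e))"
proof (intro allI impI)
  fix b11 b22
  assume inv11: "b11 \<longrightarrow> (\<forall>\<Theta>\<in>rep_End (Q1' - {e}) n blk F.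
       \<forall>x\<in>coord_span {ks..<ds}. mat_vec n \<Theta> x \<in> coord_span {ks..<ds})"
    and inv22: "b22 \<longrightarrow> (\<forall>\<Theta>\<in>rep_End (Q1' - {e}) n blk F.
       \<forall>x\<in>coord_span {ds + r..<ds + dt}. mat_vec n \<Theta> x \<in> coord_span {ds + r..<ds + dt})"
  let ?X = "var_set b11 b22 ks ds dt r"
  let ?fe = "fe_matrix b11 b22 ks ds dt r (F e)"
  let ?R = "path_algebra Q0 Q1' src tgt :: (('v \<times> 'a list) \<Rightarrow> 'k) ring"
  \<comment> \<open>All four cases are handled at once: \<open>b11\<close> and \<open>b22\<close>
    only decide which blocks of \<open>?fe\<close> carry indeterminates.\<close>
  define G where "G = (\<lambda>a. if a = e then ?fe else const_mat (F a))"
  have blk: "blk i \<in> Q0" if "i < n" for i using rep that by (auto simp: is_rep_def)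
  have F_supp: "i < n \<and> j < n \<and> blk i = tgt a \<and> blk j = src a" if "a \<in> Q1'" "F a i j \<noteq> 0" for a i j
    using rep that by (auto simp: is_rep_def)
  have blk_s: "blk i = src e \<longleftrightarrow> i < ds" and blk_t: "blk i = tgt e \<longleftrightarrow> ds \<le> i \<and> i < ds + dt"
    if "i < n" for i
    using layout(2) that by auto
  have X_range: "ds \<le> i \<and> i < ds + dt \<and> j < ds" if "(i, j) \<in> ?X" for i j
    using that sizes by (auto simp: var_set_def X11_def X21_def X22_def split: if_splits)
  \<comment> \<open>Column j is the image of a basis vector, so it lies in the span of the image
    basis, and it vanishes when that vector belongs to the kernel basis.\<close>
  have Fe_supp: "ds \<le> i \<and> i < ds + r \<and> ks \<le> j \<and> j < ds" if nz: "F e i j \<noteq> 0" for i j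
  proof -
    have ij: "i < n" "j < n" "j < ds" using F_supp[OF e_arrow nz] blk_s by auto
    have d: "(\<lambda>l. if l = j then 1 else 0) \<in> coord_span {..<ds}"
      using ij by (auto simp: coord_span_def)
    have "mat_vec n (F e) (\<lambda>l. if l = j then 1 else 0) \<in> coord_span {ds..<ds + r}"
      using d im_basis by (auto simp: im_arrow_def)
    then have "i \<in> {ds..<ds + r}"
      using ij nz unfolding mat_vec_delta[OF ij(2)] by (auto simp: coord_span_def)
    moreover have "\<not> j < ks"
    proof
      assume "j < ks"
      then have "(\<lambda>l. if l = j then 1 else 0) \<in> ker_arrow n (F e) ds"
        unfolding ker_basis by (auto simp: coord_span_def)
      then have "(\<lambda>i. if i < n then F e i j else 0) = (\<lambda>_. 0)"
        unfolding ker_arrow_def mat_vec_delta[OF ij(2), symmetric] by simp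
      from fun_cong[OF this, of i] show False using ij nz by simp
    qed
    ultimately show ?thesis using ij by auto
  qed
  \<comment> \<open>By \<open>Fe_supp\<close> the matrix of e vanishes outside the block of \<phi>,
    so the zeros of \<open>?fe\<close> away from the indeterminates also agree with it.\<close>
  have fe_const: "?fe i j = nc_const (F e i j)" if "(i, j) \<notin> ?X" for i j
    using that Fe_supp[of i j] by (cases "F e i j = 0") (auto simp: fe_matrix_def)
  have fe_var: "?fe i j = nc_var (i, j)" if "(i, j) \<in> ?X" for i j
    using that by (simp add: fe_matrix_def)
  have fe_supp: "ds \<le> i \<and> i < ds + dt \<and> j < ds" if "?fe i j \<noteq> (\<lambda>w. 0)" for i j
  proof (cases "(i, j) \<in> ?X")
    case False
    then have "F e i j \<noteq> 0" using that fe_const[OF False] by auto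
    then show ?thesis using Fe_supp[of i j] sizes by auto
  qed (rule X_range)
  have fe_in: "?fe \<in> carrier (free_matrix_ring n ?X)"
    unfolding free_matrix_ring_carrier
  proof (intro allI conjI impI)
    fix i j
    show "?fe i j \<in> carrier (free_algebra ?X)"
      by (cases "(i, j) \<in> ?X")
        (simp_all add: fe_var fe_const nc_var_in_free_algebra nc_const_in_free_algebra)
    show "?fe i j = (\<lambda>w. 0)" if "\<not> (i < n \<and> j < n)"
      using that fe_supp[of i j] layout(1) by (cases "?fe i j = (\<lambda>w. 0)") auto
  qed
  have F_in: "const_mat (F a) \<in> carrier (free_matrix_ring n ?X)" if "a \<in> Q1'" for a
    using F_supp[OF that] by (intro const_mat_in_free_matrix_ring) auto
  interpret nc_rep Q0 Q1' src tgt n blk ?X G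
  proof
    show "finite_quiver Q0 Q1' src tgt" by (rule Q'_fin)
    show "blk i \<in> Q0" if "i < n" for i using blk that .
    show "G a \<in> carrier (free_matrix_ring n ?X)" if "a \<in> Q1'" for a
      using that fe_in F_in by (auto simp: G_def)
    show "blk i = tgt a \<and> blk j = src a" if "a \<in> Q1'" "G a i j \<noteq> (\<lambda>w. 0)" for a i j
    proof (cases "a = e")
      case True
      then have "ds \<le> i \<and> i < ds + dt \<and> j < ds" using that fe_supp by (simp add: G_def)
      then show ?thesis using True blk_s[of j] blk_t[of i] layout(1) by auto
    next
      case False
      then have "F a i j \<noteq> 0" using that by (auto simp: G_def const_mat_def)
      then show ?thesis using F_supp that by blast
    qed
  qed
  let ?f = "nc_action n blk G"
  have arrow_valid: "valid_path Q0 Q1' src tgt (src a, [a])" if "a \<in> Q1'" for a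
    using that Q'_fin by (auto simp: valid_path_def finite_quiver_def quiver_def)
  have f_arrow: "?f (path_elem (src a, [a])) = G a" if "a \<in> Q1'" for a
    using that by (simp add: nc_action_path_elem nc_path_mat_arrow)
  have "\<rho>1 y = \<rho>2 y"
    if T: "ring T" and h1: "\<rho>1 \<in> ring_hom (free_matrix_ring n ?X) T"
      and h2: "\<rho>2 \<in> ring_hom (free_matrix_ring n ?X) T"
      and agree: "\<forall>x\<in>carrier ?R. \<rho>1 (?f x) = \<rho>2 (?f x)"
      and y: "y \<in> carrier (free_matrix_ring n ?X)"
    for T :: "'c ring" and \<rho>1 \<rho>2 y
  proof -
    have agree_arrow: "\<rho>1 (G a) = \<rho>2 (G a)" if "a \<in> Q1'" for a
      using bspec[OF agree path_elem_in[OF arrow_valid[OF that]]] f_arrow[OF that] by simp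
    have agree_vertex: "\<rho>1 (const_mat (vertex_idem n blk v)) = \<rho>2 (const_mat (vertex_idem n blk v))"
      if "v \<in> Q0" for v
    proof -
      have "path_elem (v, []) \<in> carrier ?R"
        using that by (intro path_elem_in) (auto simp: valid_path_def)
      moreover have "?f (path_elem (v, [])) = const_mat (vertex_idem n blk v)"
        by (simp add: nc_action_path_elem nc_path_mat_def)
      ultimately show ?thesis using bspec[OF agree, of "path_elem (v, [])"] by simp
    qed
    \<comment> \<open>A scalar matrix is the image of a multiple of the unit of kQ', which lies in
      the carrier because the vertex set is finite.\<close>
    have agree_scalar: "\<rho>1 (const_mat (scalar_mat n c)) = \<rho>2 (const_mat (scalar_mat n c))" for c
    proof -
      have "{p :: 'v \<times> 'a list. snd p = [] \<and> fst p \<in> Q0} \<subseteq> (\<lambda>v. (v, [])) ` Q0" by force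
      then have "finite {p :: 'v \<times> 'a list. snd p = [] \<and> fst p \<in> Q0}"
        using Q'_fin by (auto simp: finite_quiver_def intro: finite_subset)
      then have "finite {p :: 'v \<times> 'a list. (if snd p = [] \<and> fst p \<in> Q0 then c else 0) \<noteq> 0}"
        by (rule rev_finite_subset) auto
      then have "(\<lambda>p. if snd p = [] \<and> fst p \<in> Q0 then c else 0) \<in> carrier ?R"
        by (auto simp: path_algebra_def valid_path_def)
      from bspec[OF agree this] show ?thesis by (simp only: nc_action_scalar)
    qed
    interpret hom_pair T n ?X \<rho>1 \<rho>2
    proof (intro hom_pair.intro hom_pair_axioms.intro T h1 h2 agree_scalar)
      show "0 < n" using brick by (simp add: is_brick_def)
    qed
    \<comment> \<open>Arrows other than e act by constant matrices, so their agreement yields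
      relations over k. Agreement on the vertex idempotents supplies the block diagonal
      form.\<close>
    have ann_End: "\<Theta> \<in> rep_End (Q1' - {e}) n blk F" if "\<Theta> \<in> ann" for \<Theta>
    proof -
      have "mat_mult n \<Theta> (F a) = mat_mult n (F a) \<Theta>" if a: "a \<in> Q1' - {e}" for a
        using a agree_arrow[of a] by (intro ann_commutes[OF \<open>\<Theta> \<in> ann\<close> F_in]) (auto simp: G_def)
      then show ?thesis
        unfolding rep_End_def using ann_block_diagonal[OF that agree_vertex blk] by blast
    qed
    have ann_supp: "i < n \<and> j < n \<and> blk i = blk j" if "\<Theta> \<in> ann" "\<Theta> i j \<noteq> 0" for \<Theta> i j
      using ann_End[OF that(1)] that(2) by (auto simp: rep_End_def)
    have z_ker: "i < ks" if "\<Theta> \<in> ann" "\<Theta> i j \<noteq> 0" "j < ks" for \<Theta> i j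
      using coord_span_invariant_entry[of "{..<ks}" n \<Theta> "{..<ks}" j i] ker_inv
        ann_End[OF that(1)] ann_supp[OF that(1,2)] that unfolding ker_basis by auto
    have z_im: "i \<in> {ds..<ds + r}" if "\<Theta> \<in> ann" "\<Theta> i j \<noteq> 0" "j \<in> {ds..<ds + r}" for \<Theta> i j
      using coord_span_invariant_entry[of "{ds..<ds + r}" n \<Theta> "{ds..<ds + r}" j i] im_inv
        ann_End[OF that(1)] ann_supp[OF that(1,2)] that unfolding im_basis by auto
    have z11: "i \<in> {ks..<ds}" if "b11" "\<Theta> \<in> ann" "\<Theta> i j \<noteq> 0" "j \<in> {ks..<ds}" for \<Theta> i j
      using coord_span_invariant_entry[of "{ks..<ds}" n \<Theta> "{ks..<ds}" j i] inv11
        ann_End[OF that(2)] ann_supp[OF that(2,3)] that by auto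
    have z22: "i \<in> {ds + r..<ds + dt}" if "b22" "\<Theta> \<in> ann" "\<Theta> i j \<noteq> 0" "j \<in> {ds + r..<ds + dt}"
      for \<Theta> i j
      using coord_span_invariant_entry[of "{ds + r..<ds + dt}" n \<Theta> "{ds + r..<ds + dt}" j i] inv22
        ann_End[OF that(2)] ann_supp[OF that(2,3)] that by auto
    \<comment> \<open>\<open>entry_exchange\<close> for \<open>?fe\<close> is a relation with
      indeterminates in it. In this block each of them multiplies an entry that duality shows to be
      zero, so it may be replaced by the constant of the original matrix.\<close>
    have block_eq: "(\<Oplus>\<^bsub>T\<^esub>l\<in>{..<n}. scal (F e i l) \<otimes>\<^bsub>T\<^esub> entry l j)
        = (\<Oplus>\<^bsub>T\<^esub>l\<in>{..<n}. scal (F e l j) \<otimes>\<^bsub>T\<^esub> entry i l)"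
      if i: "i \<in> {ds..<ds + r}" and j: "j \<in> {ks..<ds}" for i j
    proof -
      have ij: "i < n" "j < n" using i j layout(1) sizes by auto
      have "(\<Oplus>\<^bsub>T\<^esub>l\<in>{..<n}. scal (F e i l) \<otimes>\<^bsub>T\<^esub> entry l j)
          = (\<Oplus>\<^bsub>T\<^esub>l\<in>{..<n}. \<rho>1 (unit_mat (?fe i l) 0 0) \<otimes>\<^bsub>T\<^esub> entry l j)"
      proof (rule finsum_cong'[OF refl, symmetric])
        fix l assume l: "l \<in> {..<n}"
        show "\<rho>1 (unit_mat (?fe i l) 0 0) \<otimes>\<^bsub>T\<^esub> entry l j = scal (F e i l) \<otimes>\<^bsub>T\<^esub> entry l j"
        proof (cases "(i, l) \<in> ?X")
          case True
          \<comment> \<open>The indeterminate belongs to X11 because the row lies in the image. Its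
            cofactor leads from M'_s to the kernel, and invariance of M'_s makes it zero.\<close>
          then have "b11" "l < ks"
            using i by (auto simp: var_set_def X11_def X21_def X22_def split: if_splits)
          then have "entry l j = \<zero>\<^bsub>T\<^esub>"
            using l ij j z11 by (intro entry_zeroI) force+
          moreover have "\<rho>1 (unit_mat (?fe i l) 0 0) \<in> carrier T"
            using fe_in n_pos unfolding free_matrix_ring_carrier by (intro hom_closed unit_mat_in) auto
          ultimately show ?thesis by simp
        qed (simp add: fe_const scal_def)
      qed (use ij in auto)
      also have "\<dots> = (\<Oplus>\<^bsub>T\<^esub>l\<in>{..<n}. entry i l \<otimes>\<^bsub>T\<^esub> \<rho>2 (unit_mat (?fe l j) 0 0))"
        using entry_exchange[OF fe_in _ ij] agree_arrow[OF e_arrow] by (simp add: G_def)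
      also have "\<dots> = (\<Oplus>\<^bsub>T\<^esub>l\<in>{..<n}. scal (F e l j) \<otimes>\<^bsub>T\<^esub> entry i l)"
      proof (rule finsum_cong'[OF refl])
        fix l assume l: "l \<in> {..<n}"
        show "entry i l \<otimes>\<^bsub>T\<^esub> \<rho>2 (unit_mat (?fe l j) 0 0) = scal (F e l j) \<otimes>\<^bsub>T\<^esub> entry i l"
        proof (cases "(l, j) \<in> ?X")
          case True
          \<comment> \<open>The indeterminate belongs to X22 because the column lies in M'_s. Its
            cofactor leads from M'_t to the image, and invariance of M'_t makes it zero.\<close>
          then have "b22" "l \<in> {ds + r..<ds + dt}"
            using j by (auto simp: var_set_def X11_def X21_def X22_def split: if_splits)
          then have "entry i l = \<zero>\<^bsub>T\<^esub>"
            using l ij i z22 by (intro entry_zeroI) force+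
          moreover have "\<rho>2 (unit_mat (?fe l j) 0 0) \<in> carrier T"
            using fe_in n_pos unfolding free_matrix_ring_carrier by (intro hom_closed unit_mat_in) auto
          ultimately show ?thesis by simp
        qed (use l ij in \<open>simp add: fe_const entry_scal\<close>)
      qed (use ij in auto)
      finally show ?thesis .
    qed
    have ann_scalar: "\<exists>c. \<Theta> = scalar_mat n c" if \<Theta>: "\<Theta> \<in> ann" for \<Theta>
    proof -
      have "mat_mult n \<Theta> (F e) = mat_mult n (F e) \<Theta>"
      proof (intro ext)
        fix i j
        show "mat_mult n \<Theta> (F e) i j = mat_mult n (F e) \<Theta> i j"
        proof (cases "i \<in> {ds..<ds + r} \<and> j \<in> {ks..<ds}")
          case True
          then have "i < n" "j < n" using layout(1) sizes by auto
          then show ?thesis using ann_commutes_at[OF \<Theta> _ _ block_eq, of i j] True by simp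
        next
          case False
          \<comment> \<open>Outside the block of \<phi> both products vanish term by term:
            \<open>\<Theta>\<close> maps the image into itself, and it maps the kernel into itself,
            where the matrix of e is zero.\<close>
          have "\<Theta> i l * F e l j = 0" for l
          proof (rule ccontr)
            assume "\<Theta> i l * F e l j \<noteq> 0"
            then show False using Fe_supp[of l j] z_im[OF \<Theta>, of i l] False by auto
          qed
          moreover have "F e i l * \<Theta> l j = 0" for l
          proof (rule ccontr)
            assume nz: "F e i l * \<Theta> l j \<noteq> 0"
            then have "l < n" "j < n" "blk l = blk j" using ann_supp[OF \<Theta>, of l j] by auto
            then show False
              using nz Fe_supp[of i l] z_ker[OF \<Theta>, of l j] False blk_s[of l] blk_s[of j] by force
          qed
          ultimately show ?thesis by (simp only: mat_mult_def sum.neutral_const)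
        qed
      qed
      then have "\<Theta> \<in> rep_End Q1' n blk F" using ann_End[OF \<Theta>] by (auto simp: rep_End_def)
      then show ?thesis using brick by (auto simp: is_brick_def)
    qed
    show "\<rho>1 y = \<rho>2 y"
    proof (rule homs_agree[OF unit_agree _ y])
      show "entry i j = \<zero>\<^bsub>T\<^esub>" if "i < n" "j < n" "i \<noteq> j" for i j
        using that by (intro entry_zeroI) (auto dest!: ann_scalar simp: scalar_mat_def)
      show "entry i i = entry j j" if "i < n" "j < n" for i j
        using that by (intro entry_eqI) (auto dest!: ann_scalar simp: scalar_mat_def)
      \<comment> \<open>The image of e itself is the witness for every indeterminate, since the
        indeterminate named (i, j) is its entry in position (i, j).\<close>
      show "\<exists>M\<in>carrier (free_matrix_ring n ?X). \<exists>i<n. \<exists>j<n. \<rho>1 M = \<rho>2 M \<and> M i j = nc_var x"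
        if x: "x \<in> ?X" for x
      proof -
        obtain i j where ij: "x = (i, j)" by (cases x)
        have "i < n" "j < n" using X_range[of i j] x ij layout(1) by auto
        moreover have "\<rho>1 ?fe = \<rho>2 ?fe" using agree_arrow[OF e_arrow] by (simp add: G_def)
        ultimately show ?thesis using fe_in fe_var[of i j] x ij by blast
      qed
    qed
  qed
  then have "ring_epimorphism TYPE('c) ?R (free_matrix_ring n ?X) ?f"
    unfolding ring_epimorphism_def using nc_action_hom by blast
  moreover have "?f x = const_mat (action_hom n blk F x)"
    if "x \<in> carrier (path_algebra Q0 (Q1' - {e}) src tgt)" for x
  proof (rule nc_action_const[OF _ that])
    show "is_rep Q0 (Q1' - {e}) src tgt n blk F" using rep by (auto simp: is_rep_def)
  qed (simp add: G_def)
  moreover have "?f (path_elem (src e, [e])) = ?fe" using f_arrow[OF e_arrow] by (simp add: G_def)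
  ultimately show "\<exists>f. ring_epimorphism TYPE('c) ?R (free_matrix_ring n ?X) f
          \<and> (\<forall>x\<in>carrier (path_algebra Q0 (Q1' - {e}) src tgt :: (('v \<times> 'a list) \<Rightarrow> 'k) ring).
                f x = const_mat (action_hom n blk F x))
          \<and> f (path_elem (src e, [e])) = ?fe"
    by blast
qed

end
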